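(* Let $S$ be a string of length $n$ of integers, let $\mathcal{C}$ be its Cartesian tree, and let $\mathcal{T}$ be a top-tree compression of $\mathcal{C}$. Then one can construct a data structure of size $O(|\mathcal{T}|)$ (in words, in the word-RAM model) that, given any indices $1\le i\le j\le n$, returns $\mathrm{RMQ}(i,j)$ on $S$ in $O(\mathrm{depth}(\mathcal{T}))$ time.
   Context: $\mathrm{RMQ}(i,j)$ returns the index of the smallest integer in $S[i\dots j]$. The Cartesian tree of an empty string is empty; otherwise, letting $i$ be the index of the leftmost occurrence of the minimum of $S$, the Cartesian tree of $S$ is a root whose left subtree is the Cartesian tree of $S[1,i-1]$ and whose right subtree is the Cartesian tree of $S[i+1,n]$ (an unlabeled rooted ordered binary tree; node $i$ in inorder corresponds to $S[i]$). For a rooted ordered binary tree $T$, a cluster is a connected edge-subgraph of $T$ with a top boundary node (its root) and at most one bottom boundary node (a leaf of the cluster), these being the only nodes of the cluster that may have neighbours outside it. A top-tree of $T$ is a rooted ordered binary tree whose leaves are the single-edge clusters of $T$ (labeled $e_\ell$ or $e_r$ according to whether the lower endpoint is a left or right child), whose root is the cluster consisting of all of $T$, and each of whose internal nodes is the cluster obtained by merging the (edge-disjoint) clusters of its two children, either horizontally (the two clusters share their top boundary node) or vertically (the top boundary node of the left child cluster is the bottom boundary node of the right child cluster), with the union again being a cluster; internal nodes are labeled $h$ or $v$ accordingly. A top-tree compression of $T$ is the DAG obtained from a top-tree of $T$ by representing identical (labeled) subtrees only once; $|\mathcal{T}|$ is the number of nodes of this DAG and $\mathrm{depth}(\mathcal{T})$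 is the height of the top-tree.
   Formalization: The label h of a horizontal merge also records which child, if any, contains the bottom boundary node (with bare h the size bound is false), so |T| counts subtrees identical under these labels; O(depth) is read as O(max(1, depth)), and words have at least log n + O(1) bits. *)

theory Defs
  imports "HOL-Library.Tree"
begin

section \<open>Range minimum queries and Cartesian trees\<close>

text \<open>Strings are lists; query indices are 1-based and ties go to the leftmost occurrence,
  the same rule by which the Cartesian tree selects its root.\<close>

definition rmq :: "int list \<Rightarrow> nat \<Rightarrow> nat \<Rightarrow> nat" where
  "rmq S i j = (LEAST k. is_arg_min (\<lambda>k. S ! (k - 1)) (\<lambda>k. k \<in> {i..j}) k)"

definition leftmost_min :: "int list \<Rightarrow> nat" where
  "leftmost_min S = (LEAST i. i < length S \<and> S ! i = Min (set S))"

lemma leftmost_min_less: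
  assumes "S \<noteq> []"
  shows "leftmost_min S < length S"
proof -
  have "Min (set S) \<in> set S" using assms by simp
  then obtain i where "i < length S \<and> S ! i = Min (set S)" by (auto simp: in_set_conv_nth)
  then have "leftmost_min S < length S \<and> S ! leftmost_min S = Min (set S)"
    unfolding leftmost_min_def by (rule LeastI)
  then show ?thesis by simp
qed

function cartesian_tree :: "int list \<Rightarrow> unit tree" where
  "cartesian_tree S =
     (if S = [] then Leaf
      else Node (cartesian_tree (take (leftmost_min S) S)) ()
                (cartesian_tree (drop (Suc (leftmost_min S)) S)))"
  by pat_completeness auto
termination
  by (relation "measure length") (auto simp: leftmost_min_less)

declare cartesian_tree.simps [simp del]


section \<open>Nodes, edges and clusters of a binary tree\<close>

text \<open>A node is the path leading to it from the root; an edge is a pair (parent, child).\<close>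

datatype side = Lft | Rgt

type_synonym node = "side list"
type_synonym edge = "node \<times> node"

fun nodes :: "'a tree \<Rightarrow> node set" where
  "nodes Leaf = {}"
| "nodes (Node l x r) = insert [] ((#) Lft ` nodes l \<union> (#) Rgt ` nodes r)"

definition edges :: "'a tree \<Rightarrow> edge set" where
  "edges T = {(u, u @ [d]) |u d. u @ [d] \<in> nodes T}"

definition verts :: "edge set \<Rightarrow> node set" where
  "verts X = fst ` X \<union> snd ` X"

definition connected_edges :: "edge set \<Rightarrow> bool" where
  "connected_edges X \<longleftrightarrow> (\<forall>u \<in> verts X. \<forall>v \<in> verts X. (u, v) \<in> (X \<union> X\<inverse>)\<^sup>*)"

definition top_node :: "edge set \<Rightarrow> node \<Rightarrow> bool" where
  "top_node X t \<longleftrightarrow> t \<in> verts X \<and> (\<nexists>p. (p, t) \<in> X)"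

definition leaf_node :: "edge set \<Rightarrow> node \<Rightarrow> bool" where
  "leaf_node X b \<longleftrightarrow> b \<in> verts X \<and> (\<nexists>c. (b, c) \<in> X)"

text \<open>The root of a cluster always counts as its top boundary node. The bottom boundary nodes
  are the other nodes that have a neighbour outside the cluster.\<close>

definition bottom_nodes :: "'a tree \<Rightarrow> edge set \<Rightarrow> node set" where
  "bottom_nodes T X =
     {b \<in> verts X. \<not> top_node X b \<and> (\<exists>(u, v) \<in> edges T - X. b = u \<or> b = v)}"

definition cluster :: "'a tree \<Rightarrow> edge set \<Rightarrow> bool" where
  "cluster T X \<longleftrightarrow>
     X \<noteq> {} \<and> X \<subseteq> edges T \<and> connected_edges X \<and>
     card (bottom_nodes T X) \<le> 1 \<and> (\<forall>b \<in> bottom_nodes T X. leaf_node X b)"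


section \<open>Top-trees and top-tree compression\<close>

datatype ('e, 'm) merge_tree =
  Single 'e | Merge 'm "('e, 'm) merge_tree" "('e, 'm) merge_tree"

datatype merge = Horizontal | Vertical

type_synonym top_tree = "(edge, merge) merge_tree"

fun cluster_of :: "top_tree \<Rightarrow> edge set" where
  "cluster_of (Single e) = {e}"
| "cluster_of (Merge m A B) = cluster_of A \<union> cluster_of B"

text \<open>In a vertical merge the left child is the lower cluster.\<close>

fun mergeable :: "'a tree \<Rightarrow> merge \<Rightarrow> edge set \<Rightarrow> edge set \<Rightarrow> bool" where
  "mergeable T Horizontal X Y \<longleftrightarrow> (\<exists>t. top_node X t \<and> top_node Y t)"
| "mergeable T Vertical X Y \<longleftrightarrow> (\<exists>t. top_node X t \<and> t \<in> bottom_nodes T Y)"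

fun cluster_hierarchy :: "'a tree \<Rightarrow> top_tree \<Rightarrow> bool" where
  "cluster_hierarchy T (Single e) \<longleftrightarrow> cluster T {e}"
| "cluster_hierarchy T (Merge m A B) \<longleftrightarrow>
     cluster_hierarchy T A \<and> cluster_hierarchy T B \<and>
     cluster_of A \<inter> cluster_of B = {} \<and>
     mergeable T m (cluster_of A) (cluster_of B) \<and>
     cluster T (cluster_of A \<union> cluster_of B)"

definition is_top_tree :: "'a tree \<Rightarrow> top_tree \<Rightarrow> bool" where
  "is_top_tree T \<T> \<longleftrightarrow> cluster_hierarchy T \<T> \<and> cluster_of \<T> = edges T"

text \<open>Leaves carry the label \<open>Lft\<close> (for \<open>e\<^sub>l\<close>) or \<open>Rgt\<close> (for \<open>e\<^sub>r\<close>). A cluster comes with its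
  boundary nodes, so the label \<open>h\<close> also says which child, if any, contains the bottom boundary
  node of the merged cluster. The letter \<open>h\<close> alone would not do: \<open>h(e\<^sub>l, e\<^sub>r)\<close> is a root with two
  children whichever of them is the bottom boundary node, and \<open>v(e\<^sub>l, h(e\<^sub>l, e\<^sub>r))\<close> would describe two
  different trees. All other bottom boundary nodes are then determined: for a single edge it can
  only be the lower endpoint, and for a vertical merge only that of the left child.\<close>

datatype merge_label = Label_h "side option" | Label_v

definition bottom_child :: "'a tree \<Rightarrow> edge set \<Rightarrow> edge set \<Rightarrow> side option" where
  "bottom_child T X Y =
     (if bottom_nodes T (X \<union> Y) \<inter> verts X \<noteq> {} then Some Lft
      else if bottom_nodes T (X \<union> Y) \<inter> verts Y \<noteq> {} then Some Rgt
      else None)"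

fun labelled :: "'a tree \<Rightarrow> top_tree \<Rightarrow> (side, merge_label) merge_tree" where
  "labelled T (Single (u, v)) = Single (last v)"
| "labelled T (Merge Horizontal A B) =
     Merge (Label_h (bottom_child T (cluster_of A) (cluster_of B))) (labelled T A) (labelled T B)"
| "labelled T (Merge Vertical A B) = Merge Label_v (labelled T A) (labelled T B)"

text \<open>The nodes of the DAG are the distinct subtrees of the labelled top-tree.\<close>

fun dag_nodes :: "('e, 'm) merge_tree \<Rightarrow> ('e, 'm) merge_tree set" where
  "dag_nodes (Single e) = {Single e}"
| "dag_nodes (Merge m A B) = insert (Merge m A B) (dag_nodes A \<union> dag_nodes B)"

definition compressed_size :: "'a tree \<Rightarrow> top_tree \<Rightarrow> nat" where
  "compressed_size T \<T> = card (dag_nodes (labelled T \<T>))"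

fun depth :: "('e, 'm) merge_tree \<Rightarrow> nat" where
  "depth (Single e) = 0"
| "depth (Merge m A B) = Suc (max (depth A) (depth B))"


section \<open>Word-RAM programs\<close>

text \<open>Words are the natural numbers below \<open>2 ^ w\<close>. A program mentions finitely many registers and
  a memory of fixed length; an access outside the memory has no execution.
  Every operation and every test takes one time unit.\<close>

datatype binop =
  PLUS | MINUS | TIMES | DIV | MOD | AND | OR | XOR | SHL | SHR | EQUAL | LESS

fun word_op :: "nat \<Rightarrow> binop \<Rightarrow> nat \<Rightarrow> nat \<Rightarrow> nat" where
  "word_op w PLUS x y = (x + y) mod 2 ^ w"
| "word_op w MINUS x y = nat ((int x - int y) mod 2 ^ w)"
| "word_op w TIMES x y = (x * y) mod 2 ^ w"
| "word_op w DIV x y = x div y"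
| "word_op w MOD x y = x mod y"
| "word_op w AND x y = Bit_Operations.and x y"
| "word_op w OR x y = Bit_Operations.or x y"
| "word_op w XOR x y = Bit_Operations.xor x y"
| "word_op w SHL x y = (x * 2 ^ y) mod 2 ^ w"
| "word_op w SHR x y = x div 2 ^ y"
| "word_op w EQUAL x y = of_bool (x = y) mod 2 ^ w"
| "word_op w LESS x y = of_bool (x < y) mod 2 ^ w"

type_synonym reg = nat
type_synonym state = "(reg \<Rightarrow> nat) \<times> nat list"

datatype prog =
    Skip
  | Const reg nat
  | Op reg binop reg reg
  | Load reg reg
  | Store reg reg
  | Seq prog prog
  | If reg prog prog
  | While reg prog

text \<open>\<open>Load r a\<close> reads into register \<open>r\<close> the memory cell whose address is in register \<open>a\<close>;
  \<open>Store a r\<close> writes register \<open>r\<close> to that cell. \<open>exec w p s t s'\<close> means that \<open>p\<close>, started in state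
  \<open>s\<close>, terminates after \<open>t\<close> time units in state \<open>s'\<close>.\<close>

inductive exec :: "nat \<Rightarrow> prog \<Rightarrow> state \<Rightarrow> nat \<Rightarrow> state \<Rightarrow> bool" for w where
  Skip: "exec w Skip s 1 s"
| Const: "exec w (Const r k) (\<rho>, M) 1 (\<rho>(r := k mod 2 ^ w), M)"
| Op: "exec w (Op r f a b) (\<rho>, M) 1 (\<rho>(r := word_op w f (\<rho> a) (\<rho> b)), M)"
| Load: "\<rho> a < length M \<Longrightarrow> exec w (Load r a) (\<rho>, M) 1 (\<rho>(r := M ! \<rho> a), M)"
| Store: "\<rho> a < length M \<Longrightarrow> exec w (Store a r) (\<rho>, M) 1 (\<rho>, M[\<rho> a := \<rho> r])"
| Seq: "exec w p s t s' \<Longrightarrow> exec w q s' t' s'' \<Longrightarrow> exec w (Seq p q) s (t + t') s''"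
| If_nonzero: "\<rho> r \<noteq> 0 \<Longrightarrow> exec w p (\<rho>, M) t s \<Longrightarrow> exec w (If r p q) (\<rho>, M) (Suc t) s"
| If_zero: "\<rho> r = 0 \<Longrightarrow> exec w q (\<rho>, M) t s \<Longrightarrow> exec w (If r p q) (\<rho>, M) (Suc t) s"
| While_stop: "\<rho> r = 0 \<Longrightarrow> exec w (While r p) (\<rho>, M) 1 (\<rho>, M)"
| While_loop: "\<rho> r \<noteq> 0 \<Longrightarrow> exec w p (\<rho>, M) t s \<Longrightarrow> exec w (While r p) s t' s' \<Longrightarrow>
    exec w (While r p) (\<rho>, M) (Suc (t + t')) s'"

inductive_cases exec_elims:
  "exec w Skip s t s'"
  "exec w (Const r k) s t s'"
  "exec w (Op r f a b) s t s'"
  "exec w (Load r a) s t s'"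
  "exec w (Store a r) s t s'"
  "exec w (Seq p q) s t s'"
  "exec w (If r p q) s t s'"
  "exec w (While r p) s t s'"

lemma exec_deterministic:
  "exec w p s t s' \<Longrightarrow> exec w p s t2 s2 \<Longrightarrow> t2 = t \<and> s2 = s'"
proof (induction arbitrary: t2 s2 rule: exec.induct)
  case (Seq p s t s' q t' s'')
  obtain u u' s1 where "exec w p s u s1" "exec w q s1 u' s2" "t2 = u + u'"
    using Seq.prems by (rule exec_elims(6))
  with Seq.IH show ?case by metis
next
  case (If_nonzero \<rho> r p M t s q)
  obtain u where "t2 = Suc u" "exec w p (\<rho>, M) u s2"
    using If_nonzero.prems by (rule exec_elims(7)) (use If_nonzero.hyps in auto)
  with If_nonzero.IH show ?case by metis
next
  case (If_zero \<rho> r q M t s p)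
  obtain u where "t2 = Suc u" "exec w q (\<rho>, M) u s2"
    using If_zero.prems by (rule exec_elims(7)) (use If_zero.hyps in auto)
  with If_zero.IH show ?case by metis
next
  case (While_stop \<rho> r p M)
  show ?case
    using While_stop.prems by (rule exec_elims(8)) (use While_stop.hyps in auto)
next
  case (While_loop \<rho> r p M t s t' s')
  obtain u u' s1 where
    "exec w p (\<rho>, M) u s1" "exec w (While r p) s1 u' s2" "t2 = Suc (u + u')"
    using While_loop.prems by (rule exec_elims(8)) (use While_loop.hyps in auto)
  with While_loop.IH show ?case by metis
next
  case Skip
  then show ?case by (rule exec_elims(1)) simp
next
  case Const
  then show ?case by (rule exec_elims(2)) simp
next
  case Op
  then show ?case by (rule exec_elims(3)) simp
next
  case (Load \<rho> a M r)
  show ?case using Load.prems by (rule exec_elims(4)) simp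
next
  case (Store \<rho> a M r)
  show ?case using Store.prems by (rule exec_elims(5)) simp
qed

text \<open>A query finds its two arguments in registers 0 and 1, leaves its result in register 0, and
  leaves the memory as it found it, so that further queries can follow.\<close>

definition answers_query ::
  "nat \<Rightarrow> prog \<Rightarrow> nat list \<Rightarrow> nat \<Rightarrow> nat \<Rightarrow> nat \<Rightarrow> nat \<Rightarrow> bool" where
  "answers_query w p M i j t k \<longleftrightarrow>
     (\<exists>\<rho>. exec w p ((\<lambda>_. 0)(0 := i, 1 := j), M) t (\<rho>, M) \<and> \<rho> 0 = k)"

end

theory Submission
  imports Defs "HOL-Library.Sublist"
begin

text \<open>The obstacle is sharing: a node of the DAG stands for many clusters, so nothing stored
  with it may refer to a position in the whole tree. Not even the existence of a bottom boundary
  node below a single edge is known. Stored boundary indices are therefore conditional, and the gap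
  carried by the query settles the matter, being 0 when there is no such node. The bottom boundary
  node \<open>b\<close> itself has no index of the form offset plus local index, with or without the
  gap, since the hidden part may lie on both sides of it. The invariant of the descent has to leave
  \<open>b\<close> out. This is harmless: \<open>b\<close> is a leaf of its cluster and so never the
  common prefix of two distinct nodes there. Hence the two nodes must stay distinct. They do, since
  they are never both replaced by the top of a lower cluster; equal query indices are answered
  before the descent starts. The label of a horizontal merge does not say which child is on the
  left. The direction of an edge at the top of the first child decides it.\<close>

text \<open>With nodes written as paths, \<open>RMQ(i, j)\<close> is the inorder index of the longest common prefix of
  the \<open>i\<close>-th and the \<open>j\<close>-th node of the Cartesian tree. A query descends in the DAG of the top-tree
  while that common prefix stays in the current cluster, and keeps the indices of two nodes
  relative to the inorder of the cluster. In a vertical merge, both nodes lie in the lower cluster, or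
  else every node of the lower cluster can be replaced by its top without changing the common
  prefix. In a horizontal merge, both nodes lie on the same side, or else the shared root is
  the answer. The whole-tree index of a node is recovered from its local index by an offset and,
  if it comes after the bottom boundary node, by the number of nodes hidden below that node.
  All numbers that steer the descent depend only on the labelled subtree, so they
  can be stored with the nodes of the DAG.\<close>

section \<open>Inorder on paths\<close>

text \<open>Lexicographic order in which the end of a path sorts between \<open>Lft\<close> and
  \<open>Rgt\<close>.\<close>

fun inorder_less :: "node \<Rightarrow> node \<Rightarrow> bool" (infix "\<prec>" 50) where
  "[] \<prec> [] \<longleftrightarrow> False"
| "[] \<prec> d # v \<longleftrightarrow> d = Rgt"
| "c # u \<prec> [] \<longleftrightarrow> c = Lft"
| "c # u \<prec> d # v \<longleftrightarrow> (if c = d then u \<prec> v else c = Lft)"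

lemma inorder_less_irrefl [simp]: "\<not> u \<prec> u"
  by (induction u) auto

lemma inorder_less_trans: "u \<prec> v \<Longrightarrow> v \<prec> w \<Longrightarrow> u \<prec> w"
proof (induction u v arbitrary: w rule: inorder_less.induct)
  case (2 d v)
  then show ?case by (cases w) (auto split: if_splits)
next
  case (3 c u)
  then show ?case by (cases w) (auto split: if_splits)
next
  case (4 c u d v)
  then show ?case by (cases w) (auto split: if_splits)
qed auto

lemma inorder_less_asym: "u \<prec> v \<Longrightarrow> \<not> v \<prec> u"
  using inorder_less_trans inorder_less_irrefl by blast

lemma inorder_less_linear: "u \<prec> v \<or> u = v \<or> v \<prec> u"
proof (induction u v rule: inorder_less.induct)
  case (2 d v)
  then show ?case by (cases d) auto
next
  case (3 c u)
  then show ?case by (cases c) auto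
next
  case (4 c u d v)
  then show ?case by (cases c; cases d) auto
qed auto

text \<open>The comparison with \<open>a\<close> is decided within \<open>b\<close>: there
  \<open>a\<close> either ends, as a proper prefix of \<open>b\<close>, or takes the other
  branch.\<close>

lemma inorder_less_outside:
  assumes "\<not> prefix b a" "prefix b x"
  shows "x \<prec> a \<longleftrightarrow> b \<prec> a" "a \<prec> x \<longleftrightarrow> a \<prec> b"
proof -
  have "(x \<prec> a \<longleftrightarrow> b \<prec> a) \<and> (a \<prec> x \<longleftrightarrow> a \<prec> b)"
    using assms
  proof (induction b a arbitrary: x rule: inorder_less.induct)
    case (3 c u)
    then show ?case by (cases x) auto
  next
    case (4 c u d v)
    from 4(3) obtain x' where "x = c # x'" "prefix u x'" by (cases x) auto
    then show ?case using "4.IH"[of x'] "4.prems"(1) by auto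
  qed auto
  then show "x \<prec> a \<longleftrightarrow> b \<prec> a" "a \<prec> x \<longleftrightarrow> a \<prec> b" by auto
qed

lemma inorder_less_append [simp]: "w @ u \<prec> w @ v \<longleftrightarrow> u \<prec> v"
  by (induction w) auto

lemma prefix_Lft_less: "prefix (t @ [Lft]) x \<Longrightarrow> x \<prec> t"
  by (metis append.assoc append_Cons append_Nil append_Nil2 inorder_less.simps(3)
      inorder_less_append prefix_def)

lemma prefix_Rgt_greater: "prefix (t @ [Rgt]) x \<Longrightarrow> t \<prec> x"
  by (metis append.assoc append_Cons append_Nil append_Nil2 inorder_less.simps(2)
      inorder_less_append prefix_def)

lemma longest_common_prefix_outside:
  assumes "\<not> prefix b a" "prefix b x"
  shows "longest_common_prefix x a = longest_common_prefix b a"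
  using assms
proof (induction b a arbitrary: x rule: longest_common_prefix.induct)
  case (1 c u d v)
  from 1(3) obtain x' where "x = c # x'" "prefix u x'" by (cases x) auto
  then show ?case using "1.IH"[of x'] "1.prems"(1) by auto
qed (auto simp: prefix_def)

lemma longest_common_prefix_append:
  "longest_common_prefix (t @ u) (t @ v) = t @ longest_common_prefix u v"
  by (induction t) auto

section \<open>Inorder ranks in a node set and their change under merging\<close>

definition index :: "node set \<Rightarrow> node \<Rightarrow> nat" where
  "index V v = card {u \<in> V. u \<prec> v}"

lemma index_strict_mono:
  assumes "finite V" "u \<in> V" "u \<prec> v"
  shows "index V u < index V v"
  unfolding index_def
  using assms by (intro psubset_card_mono psubsetI)
    (auto intro: inorder_less_trans dest: inorder_less_asym)

lemma index_less_iff: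
  assumes "finite V" "u \<in> V" "v \<in> V"
  shows "index V u < index V v \<longleftrightarrow> u \<prec> v"
  using assms index_strict_mono inorder_less_linear by (metis less_asym less_irrefl)

lemma index_less_card:
  assumes "finite V" "v \<in> V"
  shows "index V v < card V"
proof -
  have "v \<notin> {u \<in> V. u \<prec> v}" by simp
  then have "{u \<in> V. u \<prec> v} \<subset> V" using assms(2) by blast
  then show ?thesis unfolding index_def using assms(1) by (rule psubset_card_mono[rotated])
qed

text \<open>Surjectivity is what turns a query index into a node of the tree.\<close>

lemma bij_betw_index:
  assumes "finite V"
  shows "bij_betw (index V) V {..<card V}"
proof -
  have "inj_on (index V) V"
    using index_strict_mono[OF assms] inorder_less_linear
    by (intro inj_onI) (metis less_irrefl)
  moreover have "index V ` V \<subseteq> {..<card V}"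
    using assms index_less_card by auto
  ultimately show ?thesis
    by (simp add: bij_betw_def card_image card_subset_eq)
qed

text \<open>Since \<open>t\<close> is the last node of \<open>V\<close> and the first of
  \<open>W\<close>, the inorder of \<open>W\<close> continues that of \<open>V\<close>, with
  \<open>t\<close> counted once.\<close>

lemma index_horizontal:
  assumes "finite V" "finite W" "t \<in> V" "t \<in> W"
    and V: "\<And>v. v \<in> V \<Longrightarrow> v \<noteq> t \<Longrightarrow> v \<prec> t" and W: "\<And>w. w \<in> W \<Longrightarrow> w \<noteq> t \<Longrightarrow> t \<prec> w"
  shows "a \<in> V \<Longrightarrow> index (V \<union> W) a = index V a"
    and "a \<in> W \<Longrightarrow> index (V \<union> W) a = card V - 1 + index W a"
proof -
  assume a: "a \<in> V"
  have "{u \<in> V \<union> W. u \<prec> a} = {u \<in> V. u \<prec> a}"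
    using V[OF a] V W[of _] inorder_less_asym inorder_less_trans by blast
  then show "index (V \<union> W) a = index V a" by (simp add: index_def)
next
  assume a: "a \<in> W"
  have "{u \<in> V \<union> W. u \<prec> a} = (V - {t}) \<union> {u \<in> W. u \<prec> a}"
    using a V W \<open>t \<in> W\<close> by auto (metis inorder_less_trans)+
  moreover have "(V - {t}) \<inter> {u \<in> W. u \<prec> a} = {}"
    using V W inorder_less_asym by auto
  ultimately show "index (V \<union> W) a = card V - 1 + index W a"
    using assms by (simp add: index_def card_Un_disjoint)
qed

text \<open>The set \<open>X\<close> takes the place of \<open>b\<close> as one consecutive block in
  the inorder of \<open>Y\<close>, because a node of \<open>Y\<close> other than \<open>b\<close>
  compares alike with all of \<open>X\<close>. The \<open>- 1\<close> is for \<open>b\<close>, which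
  \<open>Y\<close> already counts.\<close>

lemma index_vertical:
  assumes "finite X" "finite Y" "b \<in> X" "b \<in> Y"
    and X: "\<And>x. x \<in> X \<Longrightarrow> prefix b x" and Y: "\<And>y. y \<in> Y \<Longrightarrow> y \<noteq> b \<Longrightarrow> \<not> prefix b y"
  shows "a \<in> X \<Longrightarrow> index (X \<union> Y) a = index Y b + index X a"
    and "a \<in> Y \<Longrightarrow> a \<noteq> b \<Longrightarrow>
      index (X \<union> Y) a = index Y a + (if b \<prec> a then card X - 1 else 0)"
proof -
  assume a: "a \<in> X"
  have "u \<prec> a \<longleftrightarrow> u \<prec> b" if "u \<in> Y" "u \<noteq> b" for u
    using inorder_less_outside(2)[OF Y[OF that] X[OF a]] .
  then have "{u \<in> X \<union> Y. u \<prec> a} = {u \<in> Y. u \<prec> b} \<union> {u \<in> X. u \<prec> a}"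
    using X Y \<open>b \<in> X\<close> by auto (metis inorder_less_irrefl)
  moreover have "{u \<in> Y. u \<prec> b} \<inter> {u \<in> X. u \<prec> a} = {}"
    using X Y by auto (metis inorder_less_irrefl)
  ultimately show "index (X \<union> Y) a = index Y b + index X a"
    using assms by (simp add: index_def card_Un_disjoint)
next
  assume a: "a \<in> Y" "a \<noteq> b"
  have x: "x \<prec> a \<longleftrightarrow> b \<prec> a" if "x \<in> X" for x
    using inorder_less_outside(1)[OF Y[OF a] X[OF that]] .
  have "{u \<in> X \<union> Y. u \<prec> a} = {u \<in> Y. u \<prec> a} \<union> (if b \<prec> a then X - {b} else {})"
    using x \<open>b \<in> Y\<close> by auto
  moreover have "{u \<in> Y. u \<prec> a} \<inter> (X - {b}) = {}"
    using X Y by auto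
  ultimately show "index (X \<union> Y) a = index Y a + (if b \<prec> a then card X - 1 else 0)"
    using assms by (simp add: index_def card_Un_disjoint)
qed

section \<open>Inorder in the Cartesian tree\<close>

lemma finite_nodes [simp]: "finite (nodes T)"
  by (induction T) auto

lemma card_nodes: "card (nodes T) = size T"
proof (induction T)
  case (Node l x r)
  have "card ((#) Lft ` nodes l \<union> (#) Rgt ` nodes r) = card (nodes l) + card (nodes r)"
    by (subst card_Un_disjoint) (auto simp: card_image)
  moreover have "[] \<notin> (#) Lft ` nodes l \<union> (#) Rgt ` nodes r" by auto
  ultimately show ?case using Node by simp
qed simp

lemma index_nodes:
  "index (nodes (Node l x r)) (Lft # u) = index (nodes l) u"
  "index (nodes (Node l x r)) [] = size l"
  "index (nodes (Node l x r)) (Rgt # u) = Suc (size l + index (nodes r) u)"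
proof -
  have "{v \<in> nodes (Node l x r). v \<prec> Lft # u} = (#) Lft ` {v \<in> nodes l. v \<prec> u}" by auto
  then show "index (nodes (Node l x r)) (Lft # u) = index (nodes l) u"
    by (simp add: index_def card_image)
  have "{v \<in> nodes (Node l x r). v \<prec> []} = (#) Lft ` nodes l" by auto
  then show "index (nodes (Node l x r)) [] = size l"
    by (simp add: index_def card_image card_nodes)
  have "{v \<in> nodes (Node l x r). v \<prec> Rgt # u} =
      insert [] ((#) Lft ` nodes l \<union> (#) Rgt ` {v \<in> nodes r. v \<prec> u})" by auto
  moreover have "card ((#) Lft ` nodes l \<union> (#) Rgt ` {v \<in> nodes r. v \<prec> u}) =
      size l + index (nodes r) u"
    by (subst card_Un_disjoint) (auto simp: card_image card_nodes index_def)
  ultimately show "index (nodes (Node l x r)) (Rgt # u) = Suc (size l + index (nodes r) u)"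
    by (simp add: index_def image_iff)
qed

lemma size_cartesian_tree [simp]: "size (cartesian_tree S) = length S"
proof (induction S rule: cartesian_tree.induct)
  case (1 S)
  then show ?case
    using leftmost_min_less[of S] by (subst cartesian_tree.simps) auto
qed

lemma leftmost_min:
  assumes "S \<noteq> []"
  shows "l < length S \<Longrightarrow> S ! leftmost_min S \<le> S ! l"
    and "l < leftmost_min S \<Longrightarrow> S ! leftmost_min S < S ! l"
proof -
  have "Min (set S) \<in> set S" using assms by simp
  then obtain i where "i < length S \<and> S ! i = Min (set S)" by (auto simp: in_set_conv_nth)
  then have m: "leftmost_min S < length S \<and> S ! leftmost_min S = Min (set S)"
    unfolding leftmost_min_def by (rule LeastI)
  then show le: "S ! leftmost_min S \<le> S ! l" if "l < length S" for l
    using that by simp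
  show "S ! leftmost_min S < S ! l" if "l < leftmost_min S"
  proof -
    have "S ! l \<noteq> Min (set S)"
      using that m not_less_Least unfolding leftmost_min_def by fastforce
    then show ?thesis using le[of l] m less_trans[OF that] by fastforce
  qed
qed

text \<open>Two nodes in the same subtree are left to the induction; otherwise the root lies between
  them or is one of them, and it carries the leftmost minimum. The strict inequality to the left of
  \<open>k\<close> records the tie rule and later makes \<open>Suc k\<close> the
  \<open>LEAST\<close> candidate in \<open>rmq\<close>.\<close>

lemma cartesian_tree_lca:
  fixes S :: "int list"
  defines "N \<equiv> nodes (cartesian_tree S)"
  assumes "u \<in> N" "v \<in> N" "u \<prec> v"
  defines "k \<equiv> index N (longest_common_prefix u v)"
  shows "index N u \<le> k \<and> k \<le> index N v \<and>
    (\<forall>l. index N u \<le> l \<and> l \<le> index N v \<longrightarrow> S ! k \<le> S ! l) \<and>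
    (\<forall>l. index N u \<le> l \<and> l < k \<longrightarrow> S ! k < S ! l)"
  using assms(2-4) unfolding k_def N_def
proof (induction S arbitrary: u v rule: cartesian_tree.induct)
  case (1 S)
  show ?case
  proof (cases "S = []")
    case True
    then show ?thesis using 1 by (simp add: cartesian_tree.simps)
  next
    case False
    define m where "m = leftmost_min S"
    define l where "l = cartesian_tree (take m S)"
    define r where "r = cartesian_tree (drop (Suc m) S)"
    have ml: "m < length S" using False leftmost_min_less m_def by auto
    note min = leftmost_min[OF False, folded m_def]
    have T: "cartesian_tree S = Node l () r"
      using False by (subst cartesian_tree.simps) (simp add: l_def r_def m_def)
    have sl: "size l = m" using ml by (simp add: l_def)
    have sr: "size r = length S - Suc m" using ml by (simp add: r_def)
    note IHl = "1.IH"(1)[OF False, folded m_def, folded l_def]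
    note IHr = "1.IH"(2)[OF False, folded m_def, folded r_def]
    have ltl: "index (nodes l) x < m" if "x \<in> nodes l" for x
      using index_less_card[OF _ that] sl by (simp add: card_nodes)
    have ltr: "index (nodes r) x < length S - Suc m" if "x \<in> nodes r" for x
      using index_less_card[OF _ that] sr by (simp add: card_nodes)
    note idx = index_nodes[of l "()" r, unfolded sl]
    consider (ll) u' v' where "u = Lft # u'" "v = Lft # v'" "u' \<in> nodes l" "v' \<in> nodes l" "u' \<prec> v'"
      | (rr) u' v' where "u = Rgt # u'" "v = Rgt # v'" "u' \<in> nodes r" "v' \<in> nodes r" "u' \<prec> v'"
      | (root) "longest_common_prefix u v = []" "index (nodes (cartesian_tree S)) u \<le> m"
          "m \<le> index (nodes (cartesian_tree S)) v" "index (nodes (cartesian_tree S)) v < length S"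
    proof -
      have cases: "x = [] \<or> (\<exists>x' \<in> nodes l. x = Lft # x') \<or> (\<exists>x' \<in> nodes r. x = Rgt # x')"
        if "x \<in> nodes (cartesian_tree S)" for x
        using that by (auto simp: T)
      from cases[OF "1.prems"(1)] cases[OF "1.prems"(2)] show thesis
        using "1.prems"(3) ml that
        by (elim disjE bexE) (auto simp: T idx simp del: nodes.simps dest!: ltl ltr)
    qed
    then show ?thesis
    proof cases
      case ll
      then show ?thesis
        using IHl[of u' v'] ltl[of v'] by (auto simp: T idx simp del: nodes.simps)
    next
      case rr
      \<comment> \<open>Positions in \<open>drop (Suc m) S\<close> and indices in the right subtree
        are shifted by the same amount.\<close>
      have shift: "\<exists>x \<ge> y. l = Suc (m + x)" if "Suc (m + y) \<le> l" for l y
        using that by (intro exI[of _ "l - Suc m"]) simp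
      note IH = IHr[OF rr(3-5)]
      show ?thesis
        unfolding T rr(1,2) using IH ml
        by (auto simp: idx simp del: nodes.simps dest!: shift)
    next
      case root
      then show ?thesis using min by (auto simp: T idx simp del: nodes.simps)
    qed
  qed
qed

lemma rmq_eq_lca:
  fixes S :: "int list"
  defines "N \<equiv> nodes (cartesian_tree S)"
  assumes "u \<in> N" "v \<in> N" "u \<prec> v"
  shows "rmq S (Suc (index N u)) (Suc (index N v)) = Suc (index N (longest_common_prefix u v))"
proof -
  define k where "k = index N (longest_common_prefix u v)"
  have k: "index N u \<le> k" "k \<le> index N v"
    and le: "\<And>l. index N u \<le> l \<Longrightarrow> l \<le> index N v \<Longrightarrow> S ! k \<le> S ! l"
    and less: "\<And>l. index N u \<le> l \<Longrightarrow> l < k \<Longrightarrow> S ! k < S ! l"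
    using cartesian_tree_lca[of u S v] assms unfolding k_def N_def by auto
  show ?thesis
    unfolding rmq_def k_def[symmetric]
  proof (rule Least_equality)
    show "is_arg_min (\<lambda>k. S ! (k - 1)) (\<lambda>k. k \<in> {Suc (index N u)..Suc (index N v)}) (Suc k)"
      using k le[of "_ - 1"] by (auto simp: is_arg_min_def not_less[symmetric] Suc_le_eq)
  next
    fix y
    assume y: "is_arg_min (\<lambda>k. S ! (k - 1)) (\<lambda>k. k \<in> {Suc (index N u)..Suc (index N v)}) y"
    show "Suc k \<le> y"
    proof (rule ccontr)
      assume "\<not> Suc k \<le> y"
      then show False
        using y k less[of "y - 1"] by (auto simp: is_arg_min_def dest: spec[of _ "Suc k"])
    qed
  qed
qed

section \<open>Geometry of clusters\<close>

text \<open>Connectedness in terms of paths: the set is closed under going up to \<open>t\<close>.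
  Arguments about clusters thereby become arguments about prefixes.\<close>

definition rooted :: "edge set \<Rightarrow> node \<Rightarrow> bool" where
  "rooted X t \<longleftrightarrow> t \<in> verts X \<and>
     (\<forall>v \<in> verts X. prefix t v \<and> (\<forall>w. strict_prefix t w \<and> prefix w v \<longrightarrow> (butlast w, w) \<in> X)) \<and>
     (\<forall>(u, v) \<in> X. v \<noteq> [] \<and> u = butlast v)"

lemma verts_Un [simp]: "verts (X \<union> Y) = verts X \<union> verts Y"
  by (auto simp: verts_def)

text \<open>Take a shortest vertex as \<open>t\<close> and follow an undirected walk from it. A step
  down appends the edge just used; a step up drops the last letter, and it cannot start at
  \<open>t\<close> because the parent would be shorter.\<close>

lemma connected_rooted:
  assumes "X \<noteq> {}" "X \<subseteq> edges T" "connected_edges X"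
  obtains t where "rooted X t"
proof -
  have "verts X \<noteq> {}" using assms(1) by (auto simp: verts_def)
  then obtain t where t: "t \<in> verts X" and least: "\<And>v. v \<in> verts X \<Longrightarrow> length t \<le> length v"
    using ex_has_least_nat[of "\<lambda>v. v \<in> verts X" _ length] by blast
  have "prefix t v \<and> (\<forall>w. strict_prefix t w \<and> prefix w v \<longrightarrow> (butlast w, w) \<in> X)"
    if "(t, v) \<in> (X \<union> X\<inverse>)\<^sup>*" for v
    using that
  proof induction
    case base
    then show ?case by (auto simp: strict_prefix_def prefix_order.antisym)
  next
    case (step y z)
    from step.hyps(2) consider "(y, z) \<in> X" | "(z, y) \<in> X" by auto
    then show ?case
    proof cases
      case 1
      then obtain d where "z = y @ [d]" using assms(2) by (auto simp: edges_def)
      then show ?thesis using step.IH 1 by (auto simp: prefix_snoc)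
    next
      case 2
      then obtain d where d: "y = z @ [d]" using assms(2) by (auto simp: edges_def)
      have "z \<in> verts X" using 2 by (force simp: verts_def)
      then have "t \<noteq> y" using least[of z] d by auto
      then show ?thesis using step.IH d by (auto simp: prefix_snoc)
    qed
  qed
  moreover have "(t, v) \<in> (X \<union> X\<inverse>)\<^sup>*" if "v \<in> verts X" for v
    using assms(3) t that by (auto simp: connected_edges_def)
  moreover have "\<forall>(u, v) \<in> X. v \<noteq> [] \<and> u = butlast v"
    using assms(2) by (auto simp: edges_def)
  ultimately have "rooted X t" using t by (auto simp: rooted_def)
  then show thesis by (rule that)
qed

lemma cluster_rooted:
  assumes "cluster T X"
  obtains t where "rooted X t"
  using assms connected_rooted unfolding cluster_def by metis

lemma rooted_in_verts: "rooted X t \<Longrightarrow> t \<in> verts X"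
  by (simp add: rooted_def)

lemma rooted_prefix: "rooted X t \<Longrightarrow> v \<in> verts X \<Longrightarrow> prefix t v"
  by (simp add: rooted_def)

lemma rooted_unique: "rooted X s \<Longrightarrow> rooted X t \<Longrightarrow> s = t"
  by (meson rooted_in_verts rooted_prefix prefix_order.antisym)

lemma rooted_parent_edge: "rooted X t \<Longrightarrow> v \<in> verts X \<Longrightarrow> v \<noteq> t \<Longrightarrow> (butlast v, v) \<in> X"
  by (auto simp: rooted_def strict_prefix_def)

lemma rooted_top_edge:
  assumes "rooted X t" "v \<in> verts X" "v \<noteq> t"
  obtains d where "(t, t @ [d]) \<in> X" "prefix (t @ [d]) v"
proof -
  obtain d w where "v = t @ d # w"
    using rooted_prefix[OF assms(1,2)] assms(3) by (metis append_Nil2 neq_Nil_conv prefix_def)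
  then have p: "prefix (t @ [d]) v" by simp
  then have "(butlast (t @ [d]), t @ [d]) \<in> X"
    using assms unfolding rooted_def by (metis prefix_order.less_le_not_le prefix_snoc append_self_conv not_Cons_self2 prefix_order.eq_iff)
  then show thesis using that p by simp
qed

lemma rooted_top_node:
  assumes "rooted X t"
  shows "top_node X s \<longleftrightarrow> s = t"
proof
  assume "top_node X s"
  then show "s = t" using rooted_parent_edge[OF assms] by (auto simp: top_node_def)
next
  have "(p, t) \<notin> X" for p
  proof
    assume p: "(p, t) \<in> X"
    then have "p \<in> verts X" by (force simp: verts_def)
    moreover have "t \<noteq> [] \<and> p = butlast t" using assms p by (auto simp: rooted_def)
    ultimately have "prefix t (butlast t)" "t \<noteq> []" using assms rooted_prefix by auto
    then have "length t \<le> length (butlast t)" by (intro prefix_length_le)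
    then show False using \<open>t \<noteq> []\<close> by (cases t rule: rev_cases) auto
  qed
  then show "s = t \<Longrightarrow> top_node X s" using rooted_in_verts[OF assms] by (auto simp: top_node_def)
qed

text \<open>A vertex strictly below \<open>b\<close> would force the edge leading from
  \<open>b\<close> towards it into \<open>X\<close>.\<close>

lemma rooted_leaf:
  assumes "rooted X t" "leaf_node X b" "v \<in> verts X" "prefix b v"
  shows "v = b"
proof (rule ccontr)
  assume "v \<noteq> b"
  then obtain d w where v: "v = b @ d # w"
    using assms(4) by (metis append_Nil2 neq_Nil_conv prefix_def)
  have "prefix t b" using assms by (auto simp: leaf_node_def rooted_prefix)
  then have "strict_prefix t (b @ [d])" by (auto simp: strict_prefix_def)
  moreover have "prefix (b @ [d]) v" using v by simp
  ultimately have "(b, b @ [d]) \<in> X"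
    using assms(1,3) unfolding rooted_def by (metis butlast_snoc)
  then show False using assms(2) by (auto simp: leaf_node_def)
qed

lemma bottom_nodes_rooted:
  assumes "rooted X t"
  shows "bottom_nodes T X =
    {b \<in> verts X. b \<noteq> t \<and> (\<exists>(u, v) \<in> edges T - X. b = u \<or> b = v)}"
  by (simp add: bottom_nodes_def rooted_top_node[OF assms])

text \<open>No edge of \<open>Y\<close> ends at \<open>v\<close>, so the edges at \<open>v\<close>
  that lie outside are the same for \<open>X\<close> and for the union.\<close>

lemma bottom_nodes_Un_left:
  assumes "rooted X s" "rooted (X \<union> Y) t" "v \<in> verts X" "v \<notin> verts Y" "v \<noteq> s" "v \<noteq> t"
  shows "v \<in> bottom_nodes T (X \<union> Y) \<longleftrightarrow> v \<in> bottom_nodes T X"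
proof -
  have "(u, w) \<notin> Y" if "v = u \<or> v = w" for u w
    using that assms(4) by (force simp: verts_def)
  then show ?thesis using assms by (auto simp: bottom_nodes_rooted)
qed

lemma finite_edges: "finite (edges T)"
proof -
  have "edges T \<subseteq> (\<lambda>v. (butlast v, v)) ` nodes T" by (auto simp: edges_def image_iff)
  then show ?thesis by (rule finite_subset) simp
qed

lemma cluster_finite_verts: "cluster T X \<Longrightarrow> finite (verts X)"
  using finite_edges finite_subset unfolding cluster_def verts_def by blast

lemma finite_bottom_nodes: "cluster T X \<Longrightarrow> finite (bottom_nodes T X)"
  by (rule finite_subset[OF _ cluster_finite_verts]) (auto simp: bottom_nodes_def)

lemma bottom_nodes_unique:
  assumes "cluster T X" "a \<in> bottom_nodes T X" "b \<in> bottom_nodes T X"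
  shows "a = b"
  using assms card_le_Suc0_iff_eq[OF finite_bottom_nodes[OF assms(1)]] by (auto simp: cluster_def)

lemma edge_in_verts: "(u, v) \<in> X \<Longrightarrow> u \<in> verts X \<and> v \<in> verts X"
  by (force simp: verts_def)

text \<open>A shared vertex that is the root of neither set would have its parent edge in
  both.\<close>

lemma edges_disjoint_verts:
  assumes "rooted X s" "rooted Y t" "X \<inter> Y = {}" "v \<in> verts X" "v \<in> verts Y"
  shows "v = s \<or> v = t"
  using rooted_parent_edge[OF assms(1,4)] rooted_parent_edge[OF assms(2,5)] assms(3) by blast

lemma rooted_other_vertex:
  assumes "rooted X t" "X \<noteq> {}"
  obtains v where "v \<in> verts X" "v \<noteq> t"
proof -
  obtain u v where "(u, v) \<in> X" using assms(2) by auto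
  moreover from this have "v \<noteq> [] \<and> u = butlast v"
    using assms(1) unfolding rooted_def by blast
  then have "u \<noteq> v" by (metis append_butlast_last_id append_self_conv not_Cons_self2)
  ultimately show thesis using that edge_in_verts by metis
qed

lemma hierarchy_cluster: "cluster_hierarchy T \<T> \<Longrightarrow> cluster T (cluster_of \<T>)"
  by (cases \<T>) auto

text \<open>The geometry of a vertical merge, collected once so that every induction over top-trees
  only has to interpret it. The node \<open>b\<close> ends up in the interior, which leaves the
  boundary of the lower part.\<close>

locale vertical_clusters =
  fixes T :: "'a tree" and A B :: top_tree and b t :: node
  assumes lower: "cluster_hierarchy T A" and upper: "cluster_hierarchy T B"
    and rooted_lower: "rooted (cluster_of A) b" and rooted_upper: "rooted (cluster_of B) t"
    and rooted_Un: "rooted (cluster_of A \<union> cluster_of B) t"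
    and verts_Int: "verts (cluster_of A) \<inter> verts (cluster_of B) = {b}"
    and not_prefix_upper: "y \<in> verts (cluster_of B) \<Longrightarrow> y \<noteq> b \<Longrightarrow> \<not> prefix b y"
    and bottom_upper: "bottom_nodes T (cluster_of B) = {b}"
    and bottom_Un: "bottom_nodes T (cluster_of A \<union> cluster_of B) = bottom_nodes T (cluster_of A)"

lemma vertical_merge:
  assumes "cluster_hierarchy T (Merge Vertical A B)"
  obtains b t where "vertical_clusters T A B b t"
proof -
  define X where "X = cluster_of A"
  define Y where "Y = cluster_of B"
  note XY = X_def[symmetric] Y_def[symmetric]
  have A: "cluster_hierarchy T A" and B: "cluster_hierarchy T B"
    using assms by auto
  have cl: "cluster T (X \<union> Y)" and disj: "X \<inter> Y = {}"
    using assms(1) by (auto simp: XY)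
  have clX: "cluster T X" and clY: "cluster T Y"
    using assms(1) hierarchy_cluster[of T A] hierarchy_cluster[of T B] by (auto simp: XY)
  obtain b where b: "rooted X b" using cluster_rooted[OF clX] .
  obtain t where t: "rooted Y t" using cluster_rooted[OF clY] .
  obtain t' where t': "rooted (X \<union> Y) t'" using cluster_rooted[OF cl] .
  have bY: "b \<in> bottom_nodes T Y"
    using assms(1) rooted_top_node[OF b] by (simp add: XY)
  have bv: "b \<in> verts Y" "b \<noteq> t" using bY by (auto simp: bottom_nodes_rooted[OF t])
  have leaf: "leaf_node Y b" using clY bY by (auto simp: cluster_def)
  have "prefix t v" if "v \<in> verts (X \<union> Y)" for v
    using that rooted_prefix[OF b, of v] rooted_prefix[OF t, of v] rooted_prefix[OF t bv(1)]
    by (auto intro: prefix_order.trans)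
  then have "t' = t"
    using rooted_in_verts[OF t'] rooted_prefix[OF t'] rooted_in_verts[OF t]
    by (auto intro: prefix_order.antisym)
  have b_not_t: "v = b" if "v \<in> verts X" "v \<in> verts Y" for v
    using edges_disjoint_verts[OF b t disj that] rooted_prefix[OF b that(1)]
      rooted_prefix[OF t bv(1)] by (auto intro: prefix_order.antisym)
  then have int: "verts X \<inter> verts Y = {b}" using bv rooted_in_verts[OF b] by blast
  have bottomY: "bottom_nodes T Y = {b}" using bottom_nodes_unique[OF clY] bY by blast
  \<comment> \<open>The node \<open>b\<close> has a child within \<open>X\<close>, so it is not a
    leaf of the union, whereas bottom boundary nodes of a cluster are leaves.\<close>
  obtain x where "x \<in> verts X" "x \<noteq> b"
    using rooted_other_vertex[OF b] clX by (auto simp: cluster_def)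
  then obtain d where "(b, b @ [d]) \<in> X" using rooted_top_edge[OF b] by metis
  then have "\<not> leaf_node (X \<union> Y) b" by (auto simp: leaf_node_def)
  then have nb: "b \<notin> bottom_nodes T (X \<union> Y)" using cl by (auto simp: cluster_def)
  have "v \<in> bottom_nodes T (X \<union> Y) \<longleftrightarrow> v \<in> bottom_nodes T X" for v
  proof (cases "v \<in> verts X")
    case True
    have "b \<notin> bottom_nodes T X" by (simp add: bottom_nodes_rooted[OF b])
    moreover have "v \<notin> verts Y" "v \<noteq> t" if "v \<noteq> b"
      using b_not_t that True rooted_in_verts[OF t] by auto
    ultimately show ?thesis
      using bottom_nodes_Un_left[OF b t'[unfolded \<open>t' = t\<close>] True] nb by blast
  next
    case False
    then have "v \<noteq> b" using rooted_in_verts[OF b] by auto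
    have "v \<notin> bottom_nodes T (X \<union> Y)"
    proof
      assume v: "v \<in> bottom_nodes T (X \<union> Y)"
      then have "v \<in> verts Y" "v \<noteq> t" using False t'[unfolded \<open>t' = t\<close>]
        by (auto simp: bottom_nodes_rooted)
      then have "v \<in> bottom_nodes T Y"
        using bottom_nodes_Un_left[OF t, of X t v T] t'[unfolded \<open>t' = t\<close>] v False
        by (simp add: Un_commute[of Y X])
      then show False using bottomY \<open>v \<noteq> b\<close> by auto
    qed
    then show ?thesis using False by (auto simp: bottom_nodes_def)
  qed
  then have "bottom_nodes T (X \<union> Y) = bottom_nodes T X" by blast
  then have "vertical_clusters T A B b t"
    using A B b t t'[unfolded \<open>t' = t\<close>] int bottomY rooted_leaf[OF t leaf]
    by unfold_locales (auto simp: XY)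
  then show thesis by (rule that)
qed

lemma rooted_single:
  assumes "cluster T {(u, v)}"
  obtains d where "v = u @ [d]" "rooted {(u, v)} u" "verts {(u, v)} = {u, v}"
proof -
  obtain d where d: "v = u @ [d]" using assms by (auto simp: cluster_def edges_def)
  obtain t where t: "rooted {(u, v)} t" using cluster_rooted[OF assms] .
  have V: "verts {(u, v)} = {u, v}" by (auto simp: verts_def)
  have "t = u" using t d unfolding rooted_def V by (auto dest: prefix_length_le)
  then show thesis using that d t V by blast
qed


section \<open>Shapes of labelled top-trees\<close>

type_synonym labelled_tree = "(side, merge_label) merge_tree"

text \<open>The number of vertices: the two parts of a merge share exactly one.\<close>

fun cluster_size :: "labelled_tree \<Rightarrow> nat" where
  "cluster_size (Single d) = 2"
| "cluster_size (Merge m A B) = cluster_size A + cluster_size B - 1"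

text \<open>For a horizontal merge this is an arbitrary one of the at most two directions.\<close>

fun top_side :: "labelled_tree \<Rightarrow> side" where
  "top_side (Single d) = d"
| "top_side (Merge (Label_h c) A B) = top_side A"
| "top_side (Merge Label_v A B) = top_side B"

definition left_part :: "labelled_tree \<Rightarrow> labelled_tree \<Rightarrow> labelled_tree" where
  "left_part A B = (if top_side A = Lft then A else B)"

definition right_part :: "labelled_tree \<Rightarrow> labelled_tree \<Rightarrow> labelled_tree" where
  "right_part A B = (if top_side A = Lft then B else A)"

text \<open>The inorder index that the bottom boundary node has if there is one: a label does not tell
  whether the lower endpoint of a single edge is a boundary node.\<close>

fun bottom_index :: "labelled_tree \<Rightarrow> nat" where
  "bottom_index (Single d) = (if d = Lft then 0 else 1)"
| "bottom_index (Merge Label_v A B) = bottom_index B + bottom_index A"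
| "bottom_index (Merge (Label_h c) A B) =
     (if top_side A = Lft
      then if c = Some Lft then bottom_index A else cluster_size A - 1 + bottom_index B
      else if c = Some Rgt then bottom_index B else cluster_size B - 1 + bottom_index A)"

lemma top_side_labelled:
  assumes "cluster_hierarchy T \<T>" "rooted (cluster_of \<T>) t"
  shows "(t, t @ [top_side (labelled T \<T>)]) \<in> cluster_of \<T>"
  using assms
proof (induction \<T> arbitrary: t)
  case (Single e)
  obtain u v where e: "e = (u, v)" by fastforce
  obtain d where "v = u @ [d]" "rooted {(u, v)} u"
    using Single.prems(1) rooted_single unfolding e by (metis cluster_hierarchy.simps(1))
  then show ?case using rooted_unique Single.prems(2) unfolding e by auto
next
  case (Merge m A B)
  have A: "cluster_hierarchy T A" and B: "cluster_hierarchy T B"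
    using Merge.prems by auto
  show ?case
  proof (cases m)
    case Horizontal
    obtain s where s: "top_node (cluster_of A) s" "top_node (cluster_of B) s"
      using Merge.prems(1) Horizontal by auto
    obtain t1 where "rooted (cluster_of A) t1"
      using cluster_rooted[OF hierarchy_cluster[OF A]] .
    moreover obtain t2 where "rooted (cluster_of B) t2"
      using cluster_rooted[OF hierarchy_cluster[OF B]] .
    ultimately have sA: "rooted (cluster_of A) s" and sB: "rooted (cluster_of B) s"
      using s rooted_top_node by auto
    have "t \<in> verts (cluster_of A) \<union> verts (cluster_of B)"
      using rooted_in_verts[OF Merge.prems(2)] by simp
    then have "s = t"
      using rooted_prefix[OF sA, of t] rooted_prefix[OF sB, of t]
        rooted_prefix[OF Merge.prems(2), of s] rooted_in_verts[OF sA]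
      by (auto intro: prefix_order.antisym)
    then show ?thesis using Merge.IH(1)[OF A] sA Horizontal by auto
  next
    case Vertical
    obtain b t' where "vertical_clusters T A B b t'"
      using Merge.prems(1) unfolding Vertical by (rule vertical_merge)
    then interpret vertical_clusters T A B b t' .
    have "t' = t" using rooted_unique[OF rooted_Un] Merge.prems(2) by simp
    then show ?thesis using Merge.IH(2)[OF B] rooted_upper Vertical by auto
  qed
qed

text \<open>\<open>L\<close> and \<open>R\<close> are \<open>A\<close> and \<open>B\<close> in the order of the tree, which need not be that of the merge.\<close>

locale horizontal_clusters =
  fixes T :: "'a tree" and A B L R :: top_tree and t :: node
  assumes labelled_left: "labelled T L = left_part (labelled T A) (labelled T B)"
    and labelled_right: "labelled T R = right_part (labelled T A) (labelled T B)"
    and left_in: "L \<in> {A, B}" and right_in: "R \<in> {A, B}"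
    and left: "cluster_hierarchy T L" and right: "cluster_hierarchy T R"
    and Un_eq: "cluster_of A \<union> cluster_of B = cluster_of L \<union> cluster_of R"
    and verts_Int: "verts (cluster_of L) \<inter> verts (cluster_of R) = {t}"
    and prefix_left: "x \<in> verts (cluster_of L) \<Longrightarrow> x \<noteq> t \<Longrightarrow> prefix (t @ [Lft]) x"
    and prefix_right: "y \<in> verts (cluster_of R) \<Longrightarrow> y \<noteq> t \<Longrightarrow> prefix (t @ [Rgt]) y"
    and bottom_Un: "bottom_nodes T (cluster_of L \<union> cluster_of R) =
       bottom_nodes T (cluster_of L) \<union> bottom_nodes T (cluster_of R)"
    and top_not_bottom: "t \<notin> bottom_nodes T (cluster_of L \<union> cluster_of R)"
    and bottom_child_iff:
      "bottom_child T (cluster_of A) (cluster_of B) = Some (top_side (labelled T A)) \<longleftrightarrow>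
       bottom_nodes T (cluster_of L) \<noteq> {}"
    and bottom_one: "bottom_nodes T (cluster_of L) = {} \<or> bottom_nodes T (cluster_of R) = {}"

text \<open>At most two edges lead down from the shared top \<open>t\<close>. Each of the two
  clusters contains one of them and they have no edge in common, so each contains exactly one and
  lies entirely on that side.\<close>

lemma horizontal_merge:
  assumes "cluster_hierarchy T (Merge Horizontal A B)"
  obtains t L R where "horizontal_clusters T A B L R t"
proof -
  define X where "X = cluster_of A"
  define Y where "Y = cluster_of B"
  note XY = X_def[symmetric] Y_def[symmetric]
  have A: "cluster_hierarchy T A" and B: "cluster_hierarchy T B"
    and cl: "cluster T (X \<union> Y)" and disj: "X \<inter> Y = {}"
    using assms(1) by (auto simp: XY)
  have clX: "cluster T X" and clY: "cluster T Y"
    using hierarchy_cluster[OF A] hierarchy_cluster[OF B] by (simp_all add: XY)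
  obtain t where "top_node X t" "top_node Y t"
    using assms(1) by (auto simp: XY)
  moreover obtain t1 where "rooted X t1" using cluster_rooted[OF clX] .
  moreover obtain t2 where "rooted Y t2" using cluster_rooted[OF clY] .
  ultimately have tX: "rooted X t" and tY: "rooted Y t"
    using rooted_top_node by auto
  obtain t' where t': "rooted (X \<union> Y) t'" using cluster_rooted[OF cl] .
  have "t' \<in> verts X \<union> verts Y" using rooted_in_verts[OF t'] by simp
  then have "t' = t"
    using rooted_prefix[OF tX, of t'] rooted_prefix[OF tY, of t']
      rooted_prefix[OF t', of t] rooted_in_verts[OF tX]
    by (auto intro: prefix_order.antisym)
  then have tXY: "rooted (X \<union> Y) t" using t' by simp
  have int: "verts X \<inter> verts Y = {t}"
    using edges_disjoint_verts[OF tX tY disj] rooted_in_verts[OF tX] rooted_in_verts[OF tY] by blast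
  define d where "d = top_side (labelled T A)"
  have dX: "(t, t @ [d]) \<in> X"
    using top_side_labelled[OF A] tX by (simp add: d_def XY)
  have Y: "\<exists>d'. d' \<noteq> d \<and> (t, t @ [d']) \<in> Y \<and> prefix (t @ [d']) y"
    if y: "y \<in> verts Y" "y \<noteq> t" for y
  proof -
    obtain d' where d': "(t, t @ [d']) \<in> Y" "prefix (t @ [d']) y"
      using rooted_top_edge[OF tY y] .
    moreover have "d' \<noteq> d" using d'(1) dX disj by blast
    ultimately show ?thesis by blast
  qed
  obtain e where e: "e \<noteq> d" "(t, t @ [e]) \<in> Y"
    using Y rooted_other_vertex[OF tY] clY unfolding cluster_def by metis
  have only: "d' = e" if "d' \<noteq> d" for d' using that e(1) by (cases d; cases e; cases d') auto
  have Ye: "prefix (t @ [e]) y" if "y \<in> verts Y" "y \<noteq> t" for y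
    using Y[OF that] only by auto
  have Xd: "prefix (t @ [d]) x" if x: "x \<in> verts X" "x \<noteq> t" for x
  proof -
    obtain d' where d': "(t, t @ [d']) \<in> X" "prefix (t @ [d']) x"
      using rooted_top_edge[OF tX x] .
    moreover have "d' \<noteq> e" using d'(1) e(2) disj by blast
    ultimately show ?thesis using only[of d'] by (cases "d' = d") auto
  qed
  have nt: "t \<notin> bottom_nodes T X" "t \<notin> bottom_nodes T Y" "t \<notin> bottom_nodes T (X \<union> Y)"
    by (simp_all add: bottom_nodes_rooted[OF tX] bottom_nodes_rooted[OF tY] bottom_nodes_rooted[OF tXY])
  have sub: "bottom_nodes T Z \<subseteq> verts Z" for Z by (auto simp: bottom_nodes_def)
  have bX: "v \<in> bottom_nodes T (X \<union> Y) \<longleftrightarrow> v \<in> bottom_nodes T X" if "v \<in> verts X" for v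
    using bottom_nodes_Un_left[OF tX tXY that] int that nt by (cases "v = t") auto
  have bY: "v \<in> bottom_nodes T (X \<union> Y) \<longleftrightarrow> v \<in> bottom_nodes T Y" if "v \<in> verts Y" for v
    using bottom_nodes_Un_left[OF tY, of X t v] tXY int that nt
    by (cases "v = t") (auto simp: Un_commute)
  have bot: "bottom_nodes T (X \<union> Y) = bottom_nodes T X \<union> bottom_nodes T Y"
  proof -
    have "bottom_nodes T (X \<union> Y) \<subseteq> verts X \<union> verts Y" using sub[of "X \<union> Y"] by simp
    then show ?thesis using bX bY sub[of X] sub[of Y] by blast
  qed
  \<comment> \<open>A cluster has at most one bottom boundary node, so two of them would coincide in
    the only common vertex \<open>t\<close>, which is the top.\<close>
  have one: "bottom_nodes T X = {} \<or> bottom_nodes T Y = {}"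
  proof (rule ccontr)
    assume "\<not> ?thesis"
    then obtain a b where ab: "a \<in> bottom_nodes T X" "b \<in> bottom_nodes T Y" by blast
    then have "a = b" using bottom_nodes_unique[OF cl, of a b] bot by simp
    then have "a \<in> verts X \<inter> verts Y" using ab subsetD[OF sub] by auto
    then show False using ab(1) nt(1) by (simp add: int)
  qed
  have "bottom_nodes T (X \<union> Y) \<inter> verts X = bottom_nodes T X"
    "bottom_nodes T (X \<union> Y) \<inter> verts Y = bottom_nodes T Y"
    using bX bY sub[of X] sub[of Y] by blast+
  then have c: "bottom_child T X Y = (if bottom_nodes T X \<noteq> {} then Some Lft
      else if bottom_nodes T Y \<noteq> {} then Some Rgt else None)"
    by (simp add: bottom_child_def)
  show thesis
  proof (cases d)
    case Lft
    then have e: "e = Rgt" using e(1) by (cases e) auto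
    have "horizontal_clusters T A B A B t"
    proof (unfold_locales, unfold XY)
      show "labelled T A = left_part (labelled T A) (labelled T B)"
        "labelled T B = right_part (labelled T A) (labelled T B)"
        using Lft by (simp_all add: left_part_def right_part_def d_def)
      show "cluster_hierarchy T A" "cluster_hierarchy T B" by (fact A, fact B)
      show "verts X \<inter> verts Y = {t}" "X \<union> Y = X \<union> Y" using int by blast+
      show "prefix (t @ [Lft]) x" if "x \<in> verts X" "x \<noteq> t" for x
        using Xd[OF that] e Lft by simp
      show "prefix (t @ [Rgt]) y" if "y \<in> verts Y" "y \<noteq> t" for y
        using Ye[OF that] e Lft by simp
      show "bottom_nodes T (X \<union> Y) = bottom_nodes T X \<union> bottom_nodes T Y"
        "t \<notin> bottom_nodes T (X \<union> Y)"
        using bot nt by (simp_all add: Un_commute)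
      show "bottom_child T X Y = Some (top_side (labelled T A)) \<longleftrightarrow> bottom_nodes T X \<noteq> {}"
        "bottom_nodes T X = {} \<or> bottom_nodes T Y = {}"
        using c one Lft d_def by auto
    qed simp_all
    then show ?thesis by (rule that)
  next
    case Rgt
    then have e: "e = Lft" using e(1) by (cases e) auto
    have "horizontal_clusters T A B B A t"
    proof (unfold_locales, unfold XY)
      show "labelled T B = left_part (labelled T A) (labelled T B)"
        "labelled T A = right_part (labelled T A) (labelled T B)"
        using Rgt by (simp_all add: left_part_def right_part_def d_def)
      show "cluster_hierarchy T B" "cluster_hierarchy T A" by (fact B, fact A)
      show "verts Y \<inter> verts X = {t}" "X \<union> Y = Y \<union> X" using int by blast+
      show "prefix (t @ [Lft]) x" if "x \<in> verts Y" "x \<noteq> t" for x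
        using Ye[OF that] e Rgt by simp
      show "prefix (t @ [Rgt]) y" if "y \<in> verts X" "y \<noteq> t" for y
        using Xd[OF that] e Rgt by simp
      show "bottom_nodes T (Y \<union> X) = bottom_nodes T Y \<union> bottom_nodes T X"
        "t \<notin> bottom_nodes T (Y \<union> X)"
        using bot nt by (simp_all add: Un_commute)
      show "bottom_child T X Y = Some (top_side (labelled T A)) \<longleftrightarrow> bottom_nodes T Y \<noteq> {}"
        "bottom_nodes T Y = {} \<or> bottom_nodes T X = {}"
        using c one Rgt d_def by auto
    qed simp_all
    then show ?thesis by (rule that)
  qed
qed

lemma longest_common_prefix_commute: "longest_common_prefix u v = longest_common_prefix v u"
  by (induction u v rule: longest_common_prefix.induct) auto

lemma inorder_less_append_same [simp]:
  "u @ v \<prec> u \<longleftrightarrow> v \<prec> []" "u \<prec> u @ v \<longleftrightarrow> [] \<prec> v"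
  by (metis append_Nil2 inorder_less_append)+

lemma cluster_size_ge_2: "cluster_size D \<ge> 2"
  by (induction D) auto

text \<open>Valid for every labelled tree, with or without an actual bottom boundary node, so that
  the program can be verified without reference to clusters.\<close>

lemma bottom_index_less: "bottom_index D < cluster_size D"
proof (induction D rule: bottom_index.induct)
  case (2 A B)
  then show ?case using cluster_size_ge_2[of A] by simp
next
  case (3 c A B)
  then show ?case using cluster_size_ge_2[of A] cluster_size_ge_2[of B] by auto
qed auto

text \<open>If \<open>top_side A\<close> is \<open>Lft\<close>, the left part is the first child,
  which a label names \<open>Some Lft\<close>; if it is \<open>Rgt\<close>, the left part is the
  second child, named \<open>Some Rgt\<close>. So one test against \<open>Some (top_side A)\<close>
  asks in both cases whether the boundary node is on the left.\<close>

lemma bottom_index_Label_h: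
  "bottom_index (Merge (Label_h c) A B) =
     (if c = Some (top_side A) then bottom_index (left_part A B)
      else cluster_size (left_part A B) - 1 + bottom_index (right_part A B))"
  by (cases "top_side A") (auto simp: left_part_def right_part_def)

lemma cluster_size_parts:
  "cluster_size (Merge m A B) = cluster_size (left_part A B) + cluster_size (right_part A B) - 1"
  by (auto simp: left_part_def right_part_def)

context vertical_clusters
begin

lemma finite_lower: "finite (verts (cluster_of A))"
  using lower hierarchy_cluster cluster_finite_verts by blast

lemma finite_upper: "finite (verts (cluster_of B))"
  using upper hierarchy_cluster cluster_finite_verts by blast

lemma boundary_lower: "b \<in> verts (cluster_of A)" and boundary_upper: "b \<in> verts (cluster_of B)"
  using verts_Int by auto

lemma index_lower: "a \<in> verts (cluster_of A) \<Longrightarrow>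
    index (verts (cluster_of A) \<union> verts (cluster_of B)) a =
      index (verts (cluster_of B)) b + index (verts (cluster_of A)) a"
  by (rule index_vertical(1)[OF finite_lower finite_upper boundary_lower boundary_upper])
    (auto intro: rooted_prefix[OF rooted_lower] dest: not_prefix_upper)

lemma index_upper: "a \<in> verts (cluster_of B) \<Longrightarrow> a \<noteq> b \<Longrightarrow>
    index (verts (cluster_of A) \<union> verts (cluster_of B)) a =
      index (verts (cluster_of B)) a + (if b \<prec> a then card (verts (cluster_of A)) - 1 else 0)"
  by (rule index_vertical(2)[OF finite_lower finite_upper boundary_lower boundary_upper])
    (auto intro: rooted_prefix[OF rooted_lower] dest: not_prefix_upper)

end

context horizontal_clusters
begin

lemma finite_left: "finite (verts (cluster_of L))"
  using left hierarchy_cluster cluster_finite_verts by blast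

lemma finite_right: "finite (verts (cluster_of R))"
  using right hierarchy_cluster cluster_finite_verts by blast

lemma top_left: "t \<in> verts (cluster_of L)" and top_right: "t \<in> verts (cluster_of R)"
  using verts_Int by auto

lemma left_less: "x \<in> verts (cluster_of L) \<Longrightarrow> x \<noteq> t \<Longrightarrow> x \<prec> t"
  using prefix_left prefix_Lft_less by blast

lemma right_greater: "y \<in> verts (cluster_of R) \<Longrightarrow> y \<noteq> t \<Longrightarrow> t \<prec> y"
  using prefix_right prefix_Rgt_greater by blast

lemma index_left: "a \<in> verts (cluster_of L) \<Longrightarrow>
    index (verts (cluster_of L) \<union> verts (cluster_of R)) a = index (verts (cluster_of L)) a"
  by (rule index_horizontal(1)[OF finite_left finite_right top_left top_right])
    (auto intro: left_less right_greater)

lemma index_right: "a \<in> verts (cluster_of R) \<Longrightarrow>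
    index (verts (cluster_of L) \<union> verts (cluster_of R)) a =
      card (verts (cluster_of L)) - 1 + index (verts (cluster_of R)) a"
  by (rule index_horizontal(2)[OF finite_left finite_right top_left top_right])
    (auto intro: left_less right_greater)

end

section \<open>Numbers read off the labels agree with the clusters\<close>

lemma cluster_size_labelled:
  "cluster_hierarchy T \<T> \<Longrightarrow> cluster_size (labelled T \<T>) = card (verts (cluster_of \<T>))"
proof (induction \<T>)
  case (Single e)
  obtain u v where e: "e = (u, v)" by fastforce
  have "cluster T {(u, v)}" using Single unfolding e by simp
  then show ?case unfolding e by (rule rooted_single) simp
next
  case (Merge m A B)
  show ?case
  proof (cases m)
    case Horizontal
    obtain t L R where "horizontal_clusters T A B L R t"
      using Merge.prems unfolding Horizontal by (rule horizontal_merge)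
    then interpret horizontal_clusters T A B L R t .
    have "cluster_size (labelled T L) = card (verts (cluster_of L))"
      "cluster_size (labelled T R) = card (verts (cluster_of R))"
      using Merge.IH left_in right_in left right by auto
    moreover have "verts (cluster_of (Merge m A B)) = verts (cluster_of L) \<union> verts (cluster_of R)"
      using Un_eq by (metis cluster_of.simps(2) verts_Un)
    ultimately show ?thesis
      using card_Un_Int[OF finite_left finite_right] verts_Int Horizontal
      by (simp add: cluster_size_parts labelled_left labelled_right
          del: cluster_size.simps cluster_of.simps)
  next
    case Vertical
    obtain b t where "vertical_clusters T A B b t"
      using Merge.prems unfolding Vertical by (rule vertical_merge)
    then interpret vertical_clusters T A B b t .
    show ?thesis
      using card_Un_Int[OF finite_lower finite_upper] verts_Int Vertical Merge.IH lower upper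
      by simp
  qed
qed

lemma bottom_index_labelled:
  "cluster_hierarchy T \<T> \<Longrightarrow> b \<in> bottom_nodes T (cluster_of \<T>) \<Longrightarrow>
    bottom_index (labelled T \<T>) = index (verts (cluster_of \<T>)) b"
proof (induction \<T> arbitrary: b)
  case (Single e)
  obtain u v where e: "e = (u, v)" by fastforce
  have "cluster T {(u, v)}" using Single unfolding e by simp
  then obtain d where d: "v = u @ [d]" "rooted {(u, v)} u" "verts {(u, v)} = {u, v}"
    by (rule rooted_single)
  have "b = v" using Single.prems(2) d(2,3) by (auto simp: e bottom_nodes_rooted)
  moreover have "{x. (x = u \<or> x = v) \<and> x \<prec> v} = (if d = Lft then {} else {u})"
    using d(1) by (cases d) auto
  ultimately show ?case by (simp add: e d(3) index_def) (simp add: d(1))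
next
  case (Merge m A B)
  have sub: "b \<in> bottom_nodes T X \<Longrightarrow> b \<in> verts X" for X by (simp add: bottom_nodes_def)
  show ?case
  proof (cases m)
    case Horizontal
    obtain t L R where "horizontal_clusters T A B L R t"
      using Merge.prems(1) unfolding Horizontal by (rule horizontal_merge)
    then interpret horizontal_clusters T A B L R t .
    have V: "verts (cluster_of (Merge m A B)) = verts (cluster_of L) \<union> verts (cluster_of R)"
      using Un_eq by (metis cluster_of.simps(2) verts_Un)
    have bottom: "bottom_index (labelled T (Merge m A B)) =
        (if bottom_nodes T (cluster_of L) \<noteq> {} then bottom_index (labelled T L)
         else cluster_size (labelled T L) - 1 + bottom_index (labelled T R))"
      unfolding Horizontal labelled.simps bottom_index_Label_h bottom_child_iff
        labelled_left labelled_right ..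
    consider "b \<in> bottom_nodes T (cluster_of L)"
      | "b \<in> bottom_nodes T (cluster_of R)" "bottom_nodes T (cluster_of L) = {}"
      using Merge.prems(2) Un_eq bottom_Un bottom_one by auto
    then show ?thesis
    proof cases
      case 1
      have "bottom_index (labelled T L) = index (verts (cluster_of L)) b"
        using Merge.IH left_in left 1 by auto
      then show ?thesis
        unfolding bottom V using 1 index_left[OF sub[OF 1]] by auto
    next
      case 2
      have "bottom_index (labelled T R) = index (verts (cluster_of R)) b"
        using Merge.IH right_in right 2(1) by auto
      then show ?thesis
        unfolding bottom V
        using 2 index_right[OF sub[OF 2(1)]] cluster_size_labelled[OF left] by auto
    qed
  next
    case Vertical
    obtain a t where "vertical_clusters T A B a t"
      using Merge.prems(1) unfolding Vertical by (rule vertical_merge)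
    then interpret vertical_clusters T A B a t .
    have b: "b \<in> bottom_nodes T (cluster_of A)" using Merge.prems(2) bottom_Un by simp
    then show ?thesis
      using Merge.IH(1)[OF lower b] Merge.IH(2)[OF upper] Vertical
        index_lower[OF sub[OF b]] bottom_upper by simp
  qed
qed

section \<open>The descent as a recursive function\<close>

fun clamp :: "nat \<Rightarrow> nat \<Rightarrow> nat \<Rightarrow> nat" where
  "clamp p k i = (if i \<le> p then i else if i \<le> p + k then p else i - k)"

text \<open>A node with local index \<open>a\<close> has index \<open>off + a\<close> in the whole tree (counted from 1 in the end), plus \<open>gap\<close> if
  it comes after the bottom boundary node; \<open>gap\<close> is 0 if there is none.\<close>

fun walk :: "labelled_tree \<Rightarrow> nat \<Rightarrow> nat \<Rightarrow> nat \<Rightarrow> nat \<Rightarrow> nat" where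
  "walk (Single d) i j off gap = (if d = Lft then off + 1 + gap else off)"
| "walk (Merge Label_v A B) i j off gap =
     (let p = bottom_index B; k = cluster_size A - 1
      in if p \<le> i \<and> j \<le> p + k then walk A (i - p) (j - p) (off + p) gap
         else walk B (clamp p k i) (clamp p k j) off (gap + k))"
| "walk (Merge (Label_h c) A B) i j off gap =
     (let s = cluster_size (left_part A B) - 1; h = (if c = Some (top_side A) then gap else 0)
      in if j \<le> s then if top_side A = Lft then walk A i j off h else walk B i j off h
         else if s \<le> i
           then if top_side A = Lft then walk B (i - s) (j - s) (off + s + h) (gap - h)
                else walk A (i - s) (j - s) (off + s + h) (gap - h)
         else off + s + h)"

text \<open>The recursive calls of \<open>walk\<close> are on \<open>A\<close> and \<open>B\<close>
  themselves, which makes termination evident; this is the same equation in tree order.\<close>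

lemma walk_Label_h:
  "walk (Merge (Label_h c) A B) i j off gap =
     (let s = cluster_size (left_part A B) - 1; h = (if c = Some (top_side A) then gap else 0)
      in if j \<le> s then walk (left_part A B) i j off h
         else if s \<le> i then walk (right_part A B) (i - s) (j - s) (off + s + h) (gap - h)
         else off + s + h)"
  by (simp add: left_part_def right_part_def Let_def)


text \<open>Here \<open>F\<close> stands for the index in the whole tree. As a parameter, known only
  through its values on the cluster, it makes the claim local, and the induction need not mention
  how the cluster is embedded.\<close>

lemma walk_labelled:
  assumes "cluster_hierarchy T \<T>"
  defines "V \<equiv> verts (cluster_of \<T>)" and "Q \<equiv> bottom_nodes T (cluster_of \<T>)"
  assumes "u \<in> V" "v \<in> V" "u \<prec> v"
    and "\<And>a. a \<in> V \<Longrightarrow> a \<notin> Q \<Longrightarrow> F a = off + index V a + (if \<exists>b\<in>Q. b \<prec> a then gap else 0)"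
    and "Q = {} \<Longrightarrow> gap = 0"
  shows "walk (labelled T \<T>) (index V u) (index V v) off gap = F (longest_common_prefix u v)"
  using assms(1,4-) unfolding V_def Q_def
proof (induction \<T> arbitrary: u v off gap)
  case (Single e)
  obtain x y where e: "e = (x, y)" by fastforce
  have "cluster T {(x, y)}" using Single.prems(1) unfolding e by simp
  then obtain d where d: "y = x @ [d]" "rooted {(x, y)} x" "verts {(x, y)} = {x, y}"
    by (rule rooted_single)
  define Q where "Q = bottom_nodes T {(x, y)}"
  have Q: "Q \<subseteq> {y}" "x \<notin> Q"
    using d(2,3) by (auto simp: Q_def bottom_nodes_rooted)
  have lcp: "longest_common_prefix x y = x" "longest_common_prefix y x = x"
    using longest_common_prefix_append[of x "[]" "[d]"] longest_common_prefix_append[of x "[d]" "[]"]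
    by (simp_all add: d(1))
  have F: "F x = off + index {x, y} x + (if \<exists>b\<in>Q. b \<prec> x then gap else 0)"
    using Single.prems(5)[of x] Q(2) d(3) by (simp add: e Q_def)
  have uv: "longest_common_prefix u v = x"
    using Single.prems(2-4) d(3) lcp by (auto simp: e)
  have gap: "Q = {} \<Longrightarrow> gap = 0" using Single.prems(6) by (simp add: e Q_def)
  have "{z. (z = x \<or> z = y) \<and> z \<prec> x} = (if d = Lft then {y} else {})"
    using d(1) by (cases d) auto
  then have "index {x, y} x = (if d = Lft then 1 else 0)" by (simp add: index_def)
  \<comment> \<open>For a left edge \<open>walk\<close> adds \<open>gap\<close> in any case; this is
    right because \<open>gap\<close> is 0 if the lower endpoint is not a boundary node.\<close>
  moreover have "(\<exists>b\<in>Q. b \<prec> x) \<longleftrightarrow> d = Lft \<and> Q \<noteq> {}"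
    using Q(1) d(1) by (cases d) (auto simp: subset_singleton_iff)
  ultimately show ?case
    using F gap uv d(1) by (auto simp: e)
next
  case (Merge m A B)
  show ?case
  proof (cases m)
    case Horizontal
    obtain t L R where "horizontal_clusters T A B L R t"
      using Merge.prems(1) unfolding Horizontal by (rule horizontal_merge)
    then interpret horizontal_clusters T A B L R t .
    define V where "V = verts (cluster_of L)"
    define W where "W = verts (cluster_of R)"
    define P where "P = bottom_nodes T (cluster_of L)"
    define Q where "Q = bottom_nodes T (cluster_of R)"
    have IHL: "walk (labelled T L) (index V u) (index V v) off gap = F (longest_common_prefix u v)"
      if "u \<in> V" "v \<in> V" "u \<prec> v"
        "\<And>a. a \<in> V \<Longrightarrow> a \<notin> P \<Longrightarrow> F a = off + index V a + (if \<exists>b\<in>P. b \<prec> a then gap else 0)"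
        "P = {} \<Longrightarrow> gap = 0" for u v off gap
      using left_in Merge.IH left that unfolding V_def P_def by blast
    have IHR: "walk (labelled T R) (index W u) (index W v) off gap = F (longest_common_prefix u v)"
      if "u \<in> W" "v \<in> W" "u \<prec> v"
        "\<And>a. a \<in> W \<Longrightarrow> a \<notin> Q \<Longrightarrow> F a = off + index W a + (if \<exists>b\<in>Q. b \<prec> a then gap else 0)"
        "Q = {} \<Longrightarrow> gap = 0" for u v off gap
      using right_in Merge.IH right that unfolding W_def Q_def by blast
    note fin = finite_left[folded V_def] finite_right[folded W_def]
    note tV = top_left[folded V_def] and tW = top_right[folded W_def]
    note lt = left_less[folded V_def] and gt = right_greater[folded W_def]
    note int = verts_Int[folded V_def W_def]
    note idx = index_left[folded V_def W_def] index_right[folded V_def W_def]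
    define s where "s = card V - 1"
    have idx2: "index (V \<union> W) a = s + index W a" if "a \<in> W" for a
      using idx(2)[OF that] by (simp add: s_def)
    have size: "cluster_size (labelled T L) - 1 = s"
      using cluster_size_labelled[OF left] by (simp add: s_def V_def)
    have VW: "verts (cluster_of (Merge m A B)) = V \<union> W"
      unfolding V_def W_def using Un_eq by (metis cluster_of.simps(2) verts_Un)
    have PQ: "bottom_nodes T (cluster_of (Merge m A B)) = P \<union> Q"
      using Un_eq bottom_Un by (simp add: P_def Q_def)
    have PV: "P \<subseteq> V" "t \<notin> P" and QW: "Q \<subseteq> W" "t \<notin> Q"
      using bottom_Un top_not_bottom by (auto simp: P_def Q_def V_def W_def bottom_nodes_def)
    note one = bottom_one[folded P_def Q_def]
    have F: "F a = off + index (V \<union> W) a + (if \<exists>b\<in>P \<union> Q. b \<prec> a then gap else 0)"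
      if "a \<in> V \<union> W" "a \<notin> P \<union> Q" for a
      using Merge.prems(5)[of a] that unfolding VW PQ by blast
    have gap0: "P = {} \<Longrightarrow> Q = {} \<Longrightarrow> gap = 0" using Merge.prems(6) unfolding PQ by blast
    have uv: "u \<in> V \<union> W" "v \<in> V \<union> W" "u \<prec> v"
      using Merge.prems(2-4) unfolding VW by auto
    \<comment> \<open>The share of the gap that belongs to the left part; since at most one part has
      a bottom boundary node, \<open>gap - k\<close> is the share of the right part.\<close>
    define k where "k = (if P \<noteq> {} then gap else 0)"
    have walk: "walk (labelled T (Merge m A B)) i j off gap =
        (if j \<le> s then walk (labelled T L) i j off k
         else if s \<le> i then walk (labelled T R) (i - s) (j - s) (off + s + k) (gap - k)
         else off + s + k)" for i j
      unfolding Horizontal labelled.simps walk_Label_h bottom_child_iff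
        labelled_left[symmetric] labelled_right[symmetric] size Let_def k_def P_def by simp
    have indV: "index V a \<le> s" if "a \<in> V" for a
      using index_less_card[OF fin(1) that] by (simp add: s_def)
    have indt: "index V t = s"
    proof -
      have "{x \<in> V. x \<prec> t} = V - {t}" using lt by auto
      then show ?thesis using tV fin(1) by (simp add: index_def s_def)
    qed
    have indt': "index W t = 0"
    proof -
      have "{x \<in> W. x \<prec> t} = {}" using gt inorder_less_asym inorder_less_irrefl by blast
      then show ?thesis unfolding index_def by (simp only: card.empty)
    qed
    have FV: "F a = off + index V a + (if \<exists>b\<in>P. b \<prec> a then k else 0)" if "a \<in> V" "a \<notin> P" for a
    proof -
      have "\<not> b \<prec> a" if "b \<in> Q" for b
        using that QW \<open>a \<in> V\<close> lt[of a] gt[of b] inorder_less_trans inorder_less_asym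
        by (metis subsetD)
      moreover have "a \<notin> Q" using QW int that by auto
      ultimately show ?thesis using F[of a] that idx(1)[of a] by (auto simp: k_def)
    qed
    have FW: "F a = off + s + k + index W a + (if \<exists>b\<in>Q. b \<prec> a then gap - k else 0)"
      if "a \<in> W" "a \<notin> Q" for a
    proof -
      have "b \<prec> a" if "b \<in> P" for b
        using that PV \<open>a \<in> W\<close> lt[of b] gt[of a] inorder_less_trans
        by (metis subsetD)
      moreover have "a \<notin> P" using PV int that by auto
      ultimately show ?thesis
        using F[of a] that idx(2)[of a] one by (auto simp: k_def s_def)
    qed
    \<comment> \<open>The root \<open>t\<close> is in both parts. Pairs with \<open>v = t\<close> go
      to the left and pairs with \<open>u = t\<close> to the right, in agreement with the tests on
      \<open>s\<close>. The fourth case contradicts \<open>u \<prec> v\<close>.\<close>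
    consider "u \<in> V" "v \<in> V" | "u \<in> W" "v \<in> W" "v \<notin> V"
      | "u \<in> V" "u \<notin> W" "v \<in> W" "v \<notin> V" | "u \<in> W" "v \<in> V" "u \<notin> V"
      using uv by blast
    then show ?thesis
    proof cases
      case 1
      have "walk (labelled T L) (index V u) (index V v) off k = F (longest_common_prefix u v)"
        using 1 uv(3) FV by (rule IHL) (auto simp: k_def)
      then show ?thesis unfolding VW walk using indV[OF 1(2)] 1 by (simp add: idx)
    next
      case 2
      have "v \<noteq> t" using tV 2 by auto
      then have "index W v > 0" using index_strict_mono[OF fin(2) tW gt[of v]] 2 by simp
      moreover have "walk (labelled T R) (index W u) (index W v) (off + s + k) (gap - k) =
          F (longest_common_prefix u v)"
        using 2(1,2) uv(3) FW by (rule IHR) (use gap0 in \<open>auto simp: k_def\<close>)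
      ultimately show ?thesis unfolding VW walk using 2 by (simp add: idx(1) idx2)
    next
      case 3
      have ne: "u \<noteq> t" "v \<noteq> t" using tV tW 3 by auto
      have "index V u < s"
        using index_strict_mono[OF fin(1) 3(1) lt[OF 3(1) ne(1)]] indt by simp
      moreover have "index W v > 0" using index_strict_mono[OF fin(2) tW gt[of v]] 3 ne by simp
      moreover obtain u' v' where "u = t @ Lft # u'" "v = t @ Rgt # v'"
        using prefix_left[of u] prefix_right[of v] 3 ne by (auto simp: V_def W_def prefix_def)
      then have "longest_common_prefix u v = t" by (simp add: longest_common_prefix_append)
      moreover have "F t = off + s + k"
        using FW[OF tW QW(2)] indt' gt QW inorder_less_asym by auto
      ultimately show ?thesis unfolding VW walk using 3 by (simp add: idx(1) idx2)
    next
      case 4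
      then have "u \<noteq> t" using tV by auto
      then have "t \<prec> u" using gt 4 by auto
      moreover have "v = t \<or> v \<prec> t" using lt 4 by auto
      ultimately show ?thesis using uv(3) inorder_less_trans inorder_less_irrefl by metis
    qed
  next
    case Vertical
    obtain b t where "vertical_clusters T A B b t"
      using Merge.prems(1) unfolding Vertical by (rule vertical_merge)
    then interpret vertical_clusters T A B b t .
    define X where "X = verts (cluster_of A)"
    define Y where "Y = verts (cluster_of B)"
    define Q where "Q = bottom_nodes T (cluster_of A)"
    note fin = finite_lower[folded X_def] finite_upper[folded Y_def]
    note b = boundary_lower[folded X_def] boundary_upper[folded Y_def]
    note X = rooted_prefix[OF rooted_lower, folded X_def] and Y = not_prefix_upper[folded Y_def]
    note idx = index_lower[folded X_def Y_def] index_upper[folded X_def Y_def]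
    have QX: "Q \<subseteq> X" "b \<notin> Q"
      using rooted_lower by (auto simp: Q_def X_def bottom_nodes_rooted)
    have VW: "verts (cluster_of (Merge m A B)) = X \<union> Y" by (simp add: X_def Y_def)
    have Q: "bottom_nodes T (cluster_of (Merge m A B)) = Q" using bottom_Un by (simp add: Q_def)
    have F: "F a = off + index (X \<union> Y) a + (if \<exists>b\<in>Q. b \<prec> a then gap else 0)"
      if "a \<in> X \<union> Y" "a \<notin> Q" for a
      using Merge.prems(5)[of a] that unfolding VW Q by blast
    have gap0: "Q = {} \<Longrightarrow> gap = 0" using Merge.prems(6) unfolding Q by blast
    have uv: "u \<in> X \<union> Y" "v \<in> X \<union> Y" "u \<prec> v"
      using Merge.prems(2-4) unfolding VW by auto
    define p where "p = index Y b"
    define k where "k = card X - 1"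
    have p: "bottom_index (labelled T B) = p"
      using bottom_index_labelled[OF upper, of b] bottom_upper by (simp add: p_def Y_def)
    have k: "cluster_size (labelled T A) - 1 = k"
      using cluster_size_labelled[OF lower] by (simp add: k_def X_def)
    have walk: "walk (labelled T (Merge m A B)) i j off gap =
        (if p \<le> i \<and> j \<le> p + k then walk (labelled T A) (i - p) (j - p) (off + p) gap
         else walk (labelled T B) (clamp p k i) (clamp p k j) off (gap + k))" for i j
      unfolding Vertical labelled.simps walk.simps p k Let_def ..
    have inX: "index (X \<union> Y) a = p + index X a \<and> index X a \<le> k" if "a \<in> X" for a
      using idx(1)[OF that] index_less_card[OF fin(1) that] X Y by (auto simp: p_def k_def)
    have inY: "index (X \<union> Y) a = index Y a + (if b \<prec> a then k else 0)"
      "index Y a < p \<and> \<not> b \<prec> a \<or> p < index Y a \<and> b \<prec> a" if "a \<in> Y" "a \<noteq> b" for a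
    proof -
      show "index (X \<union> Y) a = index Y a + (if b \<prec> a then k else 0)"
        using idx(2)[OF that] X Y by (simp add: k_def)
      show "index Y a < p \<and> \<not> b \<prec> a \<or> p < index Y a \<and> b \<prec> a"
        using inorder_less_linear[of a b] that(2) index_strict_mono[OF fin(2) that(1), of b]
          index_strict_mono[OF fin(2) b(2), of a] inorder_less_asym by (auto simp: p_def)
    qed
    have outside: "x \<prec> a \<longleftrightarrow> b \<prec> a" "a \<prec> x \<longleftrightarrow> a \<prec> b"
      "longest_common_prefix x a = longest_common_prefix b a"
      if "x \<in> X" "a \<in> Y" "a \<noteq> b" for x a
      using inorder_less_outside[OF Y[OF that(2,3)] X[OF that(1)]]
        longest_common_prefix_outside[OF Y[OF that(2,3)] X[OF that(1)]] by auto
    show ?thesis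
    proof (cases "u \<in> X \<and> v \<in> X")
      case True
      have "walk (labelled T A) (index X u) (index X v) (off + p) gap = F (longest_common_prefix u v)"
        unfolding X_def
      proof (rule Merge.IH(1)[OF lower])
        show "u \<in> verts (cluster_of A)" "v \<in> verts (cluster_of A)" using True X_def by auto
        show "F a = off + p + index (verts (cluster_of A)) a +
            (if \<exists>b\<in>bottom_nodes T (cluster_of A). b \<prec> a then gap else 0)"
          if "a \<in> verts (cluster_of A)" "a \<notin> bottom_nodes T (cluster_of A)" for a
          using that F[of a] inX[of a] unfolding X_def[symmetric] Q_def[symmetric] by simp
      qed (use uv gap0 Q_def in auto)
      then show ?thesis
        unfolding VW walk using inX True by simp
    next
      case False
      \<comment> \<open>Collapse \<open>X\<close> to \<open>b\<close>. As \<open>u\<close> and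
        \<open>v\<close> are not both in \<open>X\<close>, their order and their common prefix
        survive.\<close>
      define f where "f a = (if a \<in> X then b else a)" for a
      have f: "f a \<in> Y" if "a \<in> X \<union> Y" for a using that b by (auto simp: f_def)
      have ne: "a \<noteq> b" if "a \<notin> X" for a using that b by auto
      have less: "f u \<prec> f v"
        using uv False outside[of u v] outside[of v u] ne by (auto simp: f_def)
      have lcp: "longest_common_prefix (f u) (f v) = longest_common_prefix u v"
        using uv(1,2) False outside(3)[of u v] outside(3)[of v u] ne
        by (auto simp: f_def longest_common_prefix_commute)
      \<comment> \<open>The lower cluster occupies the indices from \<open>p\<close> to
        \<open>p + k\<close> of the union; \<open>clamp\<close> contracts this block to
        \<open>p\<close>, the place of \<open>b\<close> in \<open>Y\<close>, and moves everything
        behind it up by \<open>k\<close>.\<close>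
      have clamp: "clamp p k (index (X \<union> Y) a) = index Y (f a)" if "a \<in> X \<union> Y" for a
        using that inX[of a] inY[of a] ne[of a] by (auto simp: f_def p_def)
      have not: "\<not> (p \<le> index (X \<union> Y) u \<and> index (X \<union> Y) v \<le> p + k)"
      proof -
        have "index (X \<union> Y) u < p \<or> index (X \<union> Y) u > p + k" if "u \<notin> X"
          using that uv(1) inY[of u] ne by auto
        moreover have "index (X \<union> Y) v < p \<or> index (X \<union> Y) v > p + k" if "v \<notin> X"
          using that uv(2) inY[of v] ne by auto
        moreover have "index (X \<union> Y) u < index (X \<union> Y) v"
          using index_strict_mono[OF _ uv(1,3)] fin by simp
        ultimately show ?thesis using False by linarith
      qed
      have "walk (labelled T B) (index Y (f u)) (index Y (f v)) off (gap + k) =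
          F (longest_common_prefix (f u) (f v))"
        unfolding Y_def
      proof (rule Merge.IH(2)[OF upper])
        show "f u \<in> verts (cluster_of B)" "f v \<in> verts (cluster_of B)"
          using f uv Y_def by auto
        show "F a = off + index (verts (cluster_of B)) a +
            (if \<exists>b\<in>bottom_nodes T (cluster_of B). b \<prec> a then gap + k else 0)"
          if "a \<in> verts (cluster_of B)" "a \<notin> bottom_nodes T (cluster_of B)" for a
        proof -
          have a: "a \<in> Y" "a \<noteq> b" using that bottom_upper by (auto simp: Y_def)
          then have "a \<notin> X" using verts_Int by (auto simp: X_def Y_def)
          then have "a \<notin> Q" using QX by auto
          \<comment> \<open>All of \<open>Q\<close> lies below \<open>b\<close> and so on the same
            side of \<open>a\<close> as \<open>b\<close>. Hence the old gap and the \<open>k\<close>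
            vertices of \<open>X\<close> other than \<open>b\<close> add up to a single gap at
            \<open>b\<close>.\<close>
          have "(\<exists>b\<in>Q. b \<prec> a) \<longleftrightarrow> Q \<noteq> {} \<and> b \<prec> a"
            using outside(1)[OF _ a] QX by blast
          then show ?thesis
            using F[of a] a \<open>a \<notin> Q\<close> inY(1)[OF a] gap0 bottom_upper unfolding Y_def[symmetric] by auto
        qed
      qed (use less bottom_upper in auto)
      then show ?thesis
        unfolding VW walk lcp if_not_P[OF not] clamp[OF uv(1)] clamp[OF uv(2)] .
    qed
  qed
qed

section \<open>Straight-line programs\<close>

text \<open>Loop-free programs are executed by a function, so that the simplifier can run them.\<close>

fun run :: "nat \<Rightarrow> prog \<Rightarrow> state \<Rightarrow> state option" where
  "run w Skip s = Some s"
| "run w (Const r k) (\<rho>, M) = Some (\<rho>(r := k mod 2 ^ w), M)"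
| "run w (Op r f a b) (\<rho>, M) = Some (\<rho>(r := word_op w f (\<rho> a) (\<rho> b)), M)"
| "run w (Load r a) (\<rho>, M) = (if \<rho> a < length M then Some (\<rho>(r := M ! \<rho> a), M) else None)"
| "run w (Store a r) (\<rho>, M) = (if \<rho> a < length M then Some (\<rho>, M[\<rho> a := \<rho> r]) else None)"
| "run w (Seq p q) s = Option.bind (run w p s) (run w q)"
| "run w (If r p q) (\<rho>, M) = (if \<rho> r \<noteq> 0 then run w p (\<rho>, M) else run w q (\<rho>, M))"
| "run w (While r p) s = None"

text \<open>The costs of both branches of \<open>If\<close> are added: any bound that does not
  depend on the input will do.\<close>

fun cost :: "prog \<Rightarrow> nat" where
  "cost (Seq p q) = cost p + cost q"
| "cost (If r p q) = Suc (cost p + cost q)"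
| "cost p = 1"

lemma run_exec:
  "run w p s = Some s' \<Longrightarrow> \<exists>t \<le> cost p. exec w p s t s'"
proof (induction w p s arbitrary: s' rule: run.induct)
  case (6 w p q s)
  then obtain s1 where s1: "run w p s = Some s1" "run w q s1 = Some s'"
    by (auto simp: bind_eq_Some_conv)
  then obtain t t' where "t \<le> cost p" "exec w p s t s1" "t' \<le> cost q" "exec w q s1 t' s'"
    using "6.IH" by blast
  then show ?case by (auto intro!: exI[of _ "t + t'"] exec.Seq)
next
  case (7 w r p q \<rho> M)
  show ?case
  proof (cases "\<rho> r = 0")
    case True
    then obtain t where "t \<le> cost q" "exec w q (\<rho>, M) t s'" using 7 by auto
    then show ?thesis using True by (auto intro!: exI[of _ "Suc t"] exec.If_zero)
  next
    case False
    then obtain t where "t \<le> cost p" "exec w p (\<rho>, M) t s'" using 7 by auto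
    then show ?thesis using False by (auto intro!: exI[of _ "Suc t"] exec.If_nonzero)
  qed
qed (auto simp del: One_nat_def intro!: exI[of _ 1] intro: exec.intros split: if_splits)

definition block :: "prog list \<Rightarrow> prog" where
  "block ps = foldr Seq ps Skip"

lemma run_block [simp]:
  "run w (block []) s = Some s"
  "run w (block (p # ps)) s = Option.bind (run w p s) (run w (block ps))"
  by (simp_all add: block_def)

lemma word_minus: "y \<le> x \<Longrightarrow> x < 2 ^ w \<Longrightarrow> nat ((int x - int y) mod 2 ^ w) = x - y"
proof -
  assume "y \<le> x" "x < 2 ^ w"
  then have "int x - int y = int (x - y)" "(x - y) mod 2 ^ w = x - y"
    by (simp_all add: of_nat_diff less_imp_diff_less)
  moreover have "int (x - y) mod 2 ^ w = int ((x - y) mod 2 ^ w)" by (simp add: zmod_int)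
  ultimately show ?thesis by (simp only: nat_int)
qed


section \<open>The query program\<close>

text \<open>Five words per node of the DAG: kind, two children, and the two numbers that decide how
  to descend. In the loop, registers 0 and 1 hold the local indices, 2 the address of the current
  node, 3 the offset, 4 the gap, 6 to 10 the words of the current node, and 11 to 13 temporary
  values. Register 5 holds 1 while the loop runs, and is also used as the constant 1.\<close>

fun cell :: "(labelled_tree \<Rightarrow> nat) \<Rightarrow> labelled_tree \<Rightarrow> nat list" where
  "cell ad (Single d) = [0, 0, 0, of_bool (d = Lft), of_bool (d = Lft)]"
| "cell ad (Merge (Label_h c) A B) =
     [1, ad (left_part A B), ad (right_part A B), cluster_size (left_part A B) - 1,
      of_bool (c = Some (top_side A))]"
| "cell ad (Merge Label_v A B) = [2, ad A, ad B, bottom_index B, cluster_size A - 1]"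

definition fetch :: prog where
  "fetch = block
     [Load 6 2,
      Op 11 PLUS 2 5, Load 7 11,
      Op 11 PLUS 11 5, Load 8 11,
      Op 11 PLUS 11 5, Load 9 11,
      Op 11 PLUS 11 5, Load 10 11]"

text \<open>Register 9 is the local index of the answer and register 11 the part of the gap that
  precedes it. This serves a single edge as well as the shared root of a horizontal merge.\<close>

definition halt :: prog where
  "halt = block [Op 3 PLUS 3 9, Op 3 PLUS 3 11, Const 5 0]"

text \<open>There is no move instruction; \<open>OR\<close> of a register with itself copies
  it.\<close>

definition step_horizontal :: prog where
  "step_horizontal = block
     [Op 12 LESS 9 1,
      If 12
        (block
          [Op 12 LESS 0 9,
           If 12 halt
             (block [Op 0 MINUS 0 9, Op 1 MINUS 1 9, Op 3 PLUS 3 9, Op 3 PLUS 3 11,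
                     Op 4 MINUS 4 11, Op 2 OR 8 8])])
        (block [Op 4 OR 11 11, Op 2 OR 7 7])]"

definition clamp_prog :: "reg \<Rightarrow> prog" where
  "clamp_prog r = block
     [Op 12 LESS 11 r,
      If 12 (Op r MINUS r 10) (block [Op 12 LESS 9 r, If 12 (Op r OR 9 9) Skip])]"

text \<open>The sum of the two comparisons acts as their disjunction: the upper cluster is entered
  if some index is outside the block of the lower one.\<close>

definition step_vertical :: prog where
  "step_vertical = block
     [Op 11 PLUS 9 10,
      Op 12 LESS 0 9,
      Op 13 LESS 11 1,
      Op 12 PLUS 12 13,
      If 12
        (block [clamp_prog 0, clamp_prog 1, Op 4 PLUS 4 10, Op 2 OR 8 8])
        (block [Op 0 MINUS 0 9, Op 1 MINUS 1 9, Op 3 PLUS 3 9, Op 2 OR 7 7])]"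

text \<open>The product in register 11 is the gap on the left of the answer for kinds 0 and 1, where
  word 10 is a bit. For kind 2 it may wrap around, but \<open>step_vertical\<close> overwrites it
  first.\<close>

definition body :: prog where
  "body = block
     [fetch,
      Op 11 TIMES 4 10,
      If 6 (block [Op 6 MINUS 6 5, If 6 (block [step_vertical]) step_horizontal]) halt]"

text \<open>Local indices count from 0; the offset starts at 1 so that the result counts from 1. The
  gap in register 4 is 0 from the start.\<close>

definition setup_prog :: prog where
  "setup_prog = block [Const 5 1, Op 0 MINUS 0 5, Op 1 MINUS 1 5, Const 2 0, Const 3 1]"

text \<open>For \<open>i = j\<close> register 0 already holds the answer.\<close>

definition rmq_query :: prog where
  "rmq_query = Seq (Op 2 LESS 0 1)
     (If 2 (Seq setup_prog (Seq (While 5 body) (Op 0 OR 3 3))) Skip)"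

text \<open>\<open>ready\<close> describes a register state at the head of the loop; the last conjunct
  rules out overflows.\<close>

definition ready :: "nat \<Rightarrow> labelled_tree \<Rightarrow> (labelled_tree \<Rightarrow> nat) \<Rightarrow> (reg \<Rightarrow> nat) \<Rightarrow> bool" where
  "ready N D ad \<rho> \<longleftrightarrow> \<rho> 2 = ad D \<and> \<rho> 5 = 1 \<and> \<rho> 0 < \<rho> 1 \<and> \<rho> 1 < cluster_size D \<and>
     \<rho> 3 + cluster_size D + \<rho> 4 \<le> N"

definition stored :: "nat list \<Rightarrow> (labelled_tree \<Rightarrow> nat) \<Rightarrow> labelled_tree \<Rightarrow> bool" where
  "stored M ad D \<longleftrightarrow> ad D + 4 < length M \<and> (\<forall>f < 5. M ! (ad D + f) = cell ad D ! f)"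

section \<open>One round of the loop against one unfolding of \<open>walk\<close>\<close>

lemma run_fetch:
  assumes "stored M ad D" "\<rho> 2 = ad D" "\<rho> 5 = 1" "length M < 2 ^ w"
  shows "run w fetch (\<rho>, M) = Some (\<rho>(6 := cell ad D ! 0, 7 := cell ad D ! 1, 8 := cell ad D ! 2,
    9 := cell ad D ! 3, 10 := cell ad D ! 4, 11 := ad D + 4), M)"
proof -
  define W where "W = (2 ^ w :: nat)"
  have M: "M ! (ad D + f) = cell ad D ! f" if "f < 5" for f
    using assms(1) that by (simp add: stored_def)
  have "M ! ad D = cell ad D ! 0" "M ! Suc (ad D) = cell ad D ! 1"
    "M ! Suc (Suc (ad D)) = cell ad D ! 2" "M ! Suc (Suc (Suc (ad D))) = cell ad D ! 3"
    "M ! Suc (Suc (Suc (Suc (ad D)))) = cell ad D ! 4"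
    using M[of 0] M[of 1] M[of 2] M[of 3] M[of 4] by (simp_all add: eval_nat_numeral)
  moreover have len: "Suc (Suc (Suc (Suc (ad D)))) < length M"
    using assms(1) by (simp add: stored_def)
  moreover have "x mod W = x" if "x \<le> Suc (Suc (Suc (Suc (ad D))))" for x
    using that len assms(4) by (simp add: W_def)
  ultimately show ?thesis
    using assms(2,3)
    by (simp add: fetch_def W_def[symmetric]) (rule ext, simp add: eval_nat_numeral)
qed

lemma run_clamp:
  assumes "\<rho> 11 = \<rho> 9 + \<rho> 10" "r \<notin> {9, 10, 11, 12}" "\<rho> r < 2 ^ w" "w > 0"
  shows "run w (clamp_prog r) (\<rho>, M) =
    Some (\<rho>(12 := of_bool (\<rho> 9 < \<rho> r), r := clamp (\<rho> 9) (\<rho> 10) (\<rho> r)), M)"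
proof -
  have "of_bool P mod 2 ^ w = (of_bool P :: nat)" for P
    using one_less_power[of "2 :: nat" w] assms(4) by (cases P) simp_all
  moreover have "nat ((int (\<rho> r) - int (\<rho> 10)) mod 2 ^ w) = \<rho> r - \<rho> 10" if "\<rho> 9 + \<rho> 10 < \<rho> r"
    using that assms(3) by (intro word_minus) auto
  ultimately show ?thesis
    using assms(1,2) by (auto simp: clamp_prog_def fun_eq_iff)
qed

text \<open>The loop invariant is the value of \<open>walk\<close>. A round passes to a child or
  ends the loop, so induction on the labelled tree also bounds the number of rounds.\<close>

definition steps_to :: "nat \<Rightarrow> labelled_tree \<Rightarrow> (labelled_tree \<Rightarrow> nat) \<Rightarrow> (reg \<Rightarrow> nat) \<Rightarrow> (reg \<Rightarrow> nat) \<Rightarrow> bool"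
  where "steps_to N D ad \<rho> \<rho>' \<longleftrightarrow>
    (case D of Single _ \<Rightarrow> False | Merge m A B \<Rightarrow> \<exists>E \<in> {A, B}. ready N E ad \<rho>' \<and>
       walk D (\<rho> 0) (\<rho> 1) (\<rho> 3) (\<rho> 4) = walk E (\<rho>' 0) (\<rho>' 1) (\<rho>' 3) (\<rho>' 4)) \<or>
    \<rho>' 5 = 0 \<and> \<rho>' 3 = walk D (\<rho> 0) (\<rho> 1) (\<rho> 3) (\<rho> 4)"

lemma steps_toI:
  assumes "D = Merge m A B" "E \<in> {A, B}" "ready N E ad \<rho>'"
    and "walk D (\<rho> 0) (\<rho> 1) (\<rho> 3) (\<rho> 4) = walk E (\<rho>' 0) (\<rho>' 1) (\<rho>' 3) (\<rho>' 4)"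
  shows "steps_to N D ad \<rho> \<rho>'"
  using assms(2-4) unfolding steps_to_def assms(1) merge_tree.case by blast

lemma left_part_in: "left_part A B \<in> {A, B}" and right_part_in: "right_part A B \<in> {A, B}"
  by (auto simp: left_part_def right_part_def)

text \<open>Program and \<open>walk\<close> agree on arbitrary labelled trees. \<open>ready\<close>
  is preserved because offset, cluster size and gap have a sum that never grows in the descent: what
  leaves the cluster goes into the offset or the gap.\<close>

lemma run_body:
  assumes "stored M ad D" "ready N D ad \<rho>" "length M < 2 ^ w" "N + 2 \<le> 2 ^ w"
  shows "\<exists>\<rho>'. run w body (\<rho>, M) = Some (\<rho>', M) \<and> steps_to N D ad \<rho> \<rho>'"
proof -
  define i j off gap where "i = \<rho> 0" and "j = \<rho> 1" and "off = \<rho> 3" and "gap = \<rho> 4"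
  have ready: "\<rho> 2 = ad D" "\<rho> 5 = 1" "i < j" "j < cluster_size D"
      "off + cluster_size D + gap \<le> N"
    using assms(2) by (auto simp: ready_def i_def j_def off_def gap_def)
  have md: "x mod 2 ^ w = x" if "x \<le> N + 1" for x :: nat
    using that assms(4) by simp
  have ob: "of_bool P mod 2 ^ w = (of_bool P :: nat)" for P
    by (intro md) simp
  have mn: "nat ((int x - int y) mod 2 ^ w) = x - y" if "y \<le> x" "x \<le> N + 1" for x y
    using that assms(4) by (intro word_minus) auto
  have less: "x < 2 ^ w" if "x \<le> N" for x :: nat
    using that assms(4) by simp
  have w: "w > 0" using assms(4) by (cases w) auto
  note fetch = run_fetch[OF assms(1) ready(1,2) assms(3)]
  note regs = i_def[symmetric] j_def[symmetric] j_def[symmetric, simplified] off_def[symmetric] gap_def[symmetric]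
  show ?thesis
  proof (cases D)
    case (Single d)
    then show ?thesis
      using ready by (simp add: body_def fetch halt_def md steps_to_def regs)
  next
    case (Merge m A B)
    note sizes = cluster_size_ge_2[of A] cluster_size_ge_2[of B]
    show ?thesis
    proof (cases m)
      case (Label_h c)
      define L R where "L = left_part A B" and "R = right_part A B"
      define s where "s = cluster_size L - 1"
      define h where "h = (if c = Some (top_side A) then gap else 0)"
      have size: "cluster_size D = s + cluster_size R" "cluster_size L = Suc s"
        using cluster_size_ge_2[of L] unfolding Merge cluster_size_parts
        by (simp_all add: s_def L_def R_def)
      have cell: "cell ad D = [1, ad L, ad R, s, of_bool (c = Some (top_side A))]"
        by (simp add: Merge Label_h s_def L_def R_def)
      have h: "gap * of_bool (c = Some (top_side A)) = h" "h \<le> gap" by (auto simp: h_def)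
      have walk: "walk D i j off gap =
          (if j \<le> s then walk L i j off h
           else if s \<le> i then walk R (i - s) (j - s) (off + s + h) (gap - h) else off + s + h)"
        unfolding Merge Label_h walk_Label_h by (simp add: Let_def s_def L_def R_def h_def)
      have LR: "L \<in> {A, B}" "R \<in> {A, B}"
        by (simp_all only: L_def R_def left_part_in right_part_in)
      have bounds: "i \<le> N" "j \<le> N" "off + s + gap \<le> N" "off + s + h \<le> N" "h \<le> N" "gap \<le> N"
        using ready size h(2) by auto
      consider "j \<le> s" | "s < j" "s \<le> i" | "s < j" "i < s" by linarith
      then show ?thesis
      proof cases
        case 1
        obtain \<rho>' where "run w body (\<rho>, M) = Some (\<rho>', M)" "\<rho>' 0 = i" "\<rho>' 1 = j" "\<rho>' 2 = ad L"
          "\<rho>' 3 = off" "\<rho>' 4 = h" "\<rho>' 5 = 1"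
          using 1 ready bounds size h(2)
          by (simp add: body_def fetch step_horizontal_def md ob mn regs cell h(1))
        moreover from this have "ready N L ad \<rho>'"
          using 1 ready size h(2) cluster_size_ge_2[of R] by (simp add: ready_def)
        moreover from calculation have
          "walk D i j off gap = walk L (\<rho>' 0) (\<rho>' 1) (\<rho>' 3) (\<rho>' 4)"
          using 1 by (simp add: walk)
        ultimately show ?thesis
          using steps_toI[OF Merge LR(1), of N ad \<rho>' \<rho>] unfolding regs by blast
      next
        case 2
        obtain \<rho>' where "run w body (\<rho>, M) = Some (\<rho>', M)" "\<rho>' 0 = i - s" "\<rho>' 1 = j - s" "\<rho>' 2 = ad R"
          "\<rho>' 3 = off + s + h" "\<rho>' 4 = gap - h" "\<rho>' 5 = 1"
          using 2 ready bounds size h(2) w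
          by (simp add: body_def fetch step_horizontal_def md ob mn regs cell h(1))
        moreover from this have "ready N R ad \<rho>'"
          using 2 ready size h(2) by (simp add: ready_def, intro conjI; linarith)
        moreover from calculation have
          "walk D i j off gap = walk R (\<rho>' 0) (\<rho>' 1) (\<rho>' 3) (\<rho>' 4)"
          using 2 by (simp add: walk)
        ultimately show ?thesis
          using steps_toI[OF Merge LR(2), of N ad \<rho>' \<rho>] unfolding regs by blast
      next
        case 3
        obtain \<rho>' where "run w body (\<rho>, M) = Some (\<rho>', M)" "\<rho>' 3 = off + s + h" "\<rho>' 5 = 0"
          using 3 ready bounds size h(2) w
          by (simp add: body_def fetch step_horizontal_def halt_def md ob mn regs cell h(1))
        then show ?thesis
          using 3 by (auto simp: steps_to_def regs walk)
      qed
    next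
      case Label_v
      define p where "p = bottom_index B"
      define k where "k = cluster_size A - 1"
      have size: "cluster_size D = k + cluster_size B" "cluster_size A = Suc k" "p < cluster_size B"
        using sizes bottom_index_less[of B] by (simp_all add: Merge k_def p_def)
      have cell: "cell ad D = [2, ad A, ad B, p, k]"
        by (simp add: Merge Label_v p_def k_def)
      have walk: "walk D i j off gap = (if p \<le> i \<and> j \<le> p + k
          then walk A (i - p) (j - p) (off + p) gap
          else walk B (clamp p k i) (clamp p k j) off (gap + k))"
        by (simp add: Merge Label_v p_def k_def Let_def del: clamp.simps)
      have bounds: "i \<le> N" "j \<le> N" "off + p + gap \<le> N" "p + k \<le> N" "gap + k \<le> N"
        using ready size by auto
      show ?thesis
      proof (cases "p \<le> i \<and> j \<le> p + k")
        case True
        obtain \<rho>' where "run w body (\<rho>, M) = Some (\<rho>', M)" "\<rho>' 0 = i - p" "\<rho>' 1 = j - p" "\<rho>' 2 = ad A"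
          "\<rho>' 3 = off + p" "\<rho>' 4 = gap" "\<rho>' 5 = 1"
          using True ready bounds size w
          by (simp add: body_def fetch step_vertical_def md ob mn regs cell)
        moreover from this have "ready N A ad \<rho>'"
          using conjunct1[OF True] conjunct2[OF True] ready size
          by (simp add: ready_def, intro conjI; linarith)
        moreover from calculation have
          "walk D i j off gap = walk A (\<rho>' 0) (\<rho>' 1) (\<rho>' 3) (\<rho>' 4)"
          using True by (simp add: walk)
        ultimately show ?thesis
          using steps_toI[OF Merge, of A N ad \<rho>' \<rho>] unfolding regs by blast
      next
        case False
        \<comment> \<open>At most one of the two indices is in the contracted block, so
          \<open>clamp\<close> keeps them distinct.\<close>
        then have "i < p \<or> p + k < j" by auto
        then have clamp: "clamp p k i < clamp p k j" "clamp p k j < cluster_size B"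
          using ready size by auto
        obtain \<rho>' where "run w body (\<rho>, M) = Some (\<rho>', M)"
          "\<rho>' 0 = clamp p k i" "\<rho>' 1 = clamp p k j" "\<rho>' 2 = ad B"
          "\<rho>' 3 = off" "\<rho>' 4 = gap + k" "\<rho>' 5 = 1"
          using \<open>i < p \<or> p + k < j\<close> ready bounds size w less
          by (simp add: body_def fetch step_vertical_def md ob mn regs cell run_clamp
              del: clamp.simps)
        moreover from this have "ready N B ad \<rho>'"
          using ready size clamp by (simp add: ready_def del: clamp.simps)
        moreover from calculation have
          "walk D i j off gap = walk B (\<rho>' 0) (\<rho>' 1) (\<rho>' 3) (\<rho>' 4)"
          by (simp only: walk if_not_P[OF False])
        ultimately show ?thesis
          using steps_toI[OF Merge, of B N ad \<rho>' \<rho>] unfolding regs by blast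
      qed
    qed
  qed
qed

section \<open>Running time of the loop and of a query\<close>

lemma dag_nodes_self: "D \<in> dag_nodes D"
  by (cases D) auto

text \<open>There are at most \<open>depth D + 1\<close> rounds, each paying for the body and one
  loop test; the last 1 is the final test.\<close>

lemma exec_loop:
  assumes "\<And>E. E \<in> dag_nodes D \<Longrightarrow> stored M ad E"
    and "ready N D ad \<rho>" "length M < 2 ^ w" "N + 2 \<le> 2 ^ w"
  shows "\<exists>\<rho>' t. t \<le> (cost body + 1) * (depth D + 1) + 1 \<and> exec w (While 5 body) (\<rho>, M) t (\<rho>', M) \<and>
    \<rho>' 3 = walk D (\<rho> 0) (\<rho> 1) (\<rho> 3) (\<rho> 4)"
  using assms(1,2)
proof (induction D arbitrary: \<rho>)
  case (Single d)
  then obtain \<rho>' where \<rho>': "run w body (\<rho>, M) = Some (\<rho>', M)" "steps_to N (Single d) ad \<rho> \<rho>'"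
    using run_body[OF _ Single.prems(2) assms(3,4)] by auto
  then obtain t where t: "t \<le> cost body" "exec w body (\<rho>, M) t (\<rho>', M)"
    using run_exec by blast
  have stop: "\<rho>' 5 = 0" "\<rho>' 3 = walk (Single d) (\<rho> 0) (\<rho> 1) (\<rho> 3) (\<rho> 4)"
    using \<rho>'(2) by (simp_all add: steps_to_def)
  have "\<rho> 5 \<noteq> 0" using Single.prems(2) by (simp add: ready_def)
  from exec.While_loop[OF this t(2) exec.While_stop[where \<rho> = \<rho>' and r = 5, OF stop(1)]]
  show ?case
    using t(1) stop(2) by (intro exI[of _ \<rho>'] exI[of _ "Suc (t + 1)"]) simp
next
  case (Merge m A B)
  have "\<rho> 5 \<noteq> 0" using Merge.prems(2) by (simp add: ready_def)
  obtain \<rho>1 where \<rho>1: "run w body (\<rho>, M) = Some (\<rho>1, M)" "steps_to N (Merge m A B) ad \<rho> \<rho>1"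
    using run_body[OF _ Merge.prems(2) assms(3,4)] Merge.prems(1) dag_nodes_self by blast
  then obtain t where t: "t \<le> cost body" "exec w body (\<rho>, M) t (\<rho>1, M)"
    using run_exec by blast
  from \<rho>1(2) consider (stop) "\<rho>1 5 = 0" "\<rho>1 3 = walk (Merge m A B) (\<rho> 0) (\<rho> 1) (\<rho> 3) (\<rho> 4)"
    | (child) E where "E \<in> {A, B}" "ready N E ad \<rho>1"
      "walk (Merge m A B) (\<rho> 0) (\<rho> 1) (\<rho> 3) (\<rho> 4) = walk E (\<rho>1 0) (\<rho>1 1) (\<rho>1 3) (\<rho>1 4)"
    unfolding steps_to_def merge_tree.case by (elim disjE bexE conjE) (rule that; assumption)+
  then show ?case
  proof cases
    case stop
    from exec.While_loop[OF \<open>\<rho> 5 \<noteq> 0\<close> t(2) exec.While_stop[where \<rho> = \<rho>1 and r = 5, OF stop(1)]]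
    show ?thesis
      using t(1) stop(2) by (intro exI[of _ \<rho>1] exI[of _ "Suc (t + 1)"]) simp
  next
    case child
    have "\<exists>\<rho>' t. t \<le> (cost body + 1) * (depth E + 1) + 1 \<and>
      exec w (While 5 body) (\<rho>1, M) t (\<rho>', M) \<and> \<rho>' 3 = walk E (\<rho>1 0) (\<rho>1 1) (\<rho>1 3) (\<rho>1 4)"
      using child(1,2) Merge.IH(1)[of \<rho>1] Merge.IH(2)[of \<rho>1] Merge.prems(1) by auto
    then obtain \<rho>' t' where t': "t' \<le> (cost body + 1) * (depth E + 1) + 1"
      "exec w (While 5 body) (\<rho>1, M) t' (\<rho>', M)" "\<rho>' 3 = walk E (\<rho>1 0) (\<rho>1 1) (\<rho>1 3) (\<rho>1 4)"
      by blast
    have "exec w (While 5 body) (\<rho>, M) (Suc (t + t')) (\<rho>', M)"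
      using \<open>\<rho> 5 \<noteq> 0\<close> t(2) t'(2) by (rule exec.While_loop)
    moreover have "depth E + 1 \<le> depth (Merge m A B)" using child(1) by auto
    then have "(cost body + 1) * (depth E + 1) \<le> (cost body + 1) * depth (Merge m A B)"
      by (rule mult_le_mono2)
    then have "Suc (t + t') \<le> (cost body + 1) * (depth (Merge m A B) + 1) + 1"
      using t(1) t'(1) by (simp add: distrib_left del: depth.simps)
    ultimately show ?thesis using child(3) t'(3) by metis
  qed
qed

lemma exec_query:
  assumes "\<And>E. E \<in> dag_nodes D \<Longrightarrow> stored M ad E" "ad D = 0"
    and "length M < 2 ^ w" "cluster_size D + 3 \<le> 2 ^ w"
    and ij: "1 \<le> i" "i < j" "j \<le> cluster_size D"
  shows "\<exists>t. t \<le> (cost body + 1) * (depth D + 1) + 11 \<and>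
    answers_query w rmq_query M i j t (walk D (i - 1) (j - 1) 1 0)"
proof -
  define \<rho>1 :: "reg \<Rightarrow> nat" where "\<rho>1 = (\<lambda>_. 0)(0 := i - 1, 1 := j - 1, 2 := 0, 3 := 1, 5 := 1)"
  \<comment> \<open>The initial offset 1 and gap 0 determine this bound.\<close>
  have "ready (cluster_size D + 1) D ad \<rho>1"
    using assms(2) ij by (auto simp: ready_def \<rho>1_def)
  then obtain \<rho>2 t where t: "t \<le> (cost body + 1) * (depth D + 1) + 1"
    "exec w (While 5 body) (\<rho>1, M) t (\<rho>2, M)" "\<rho>2 3 = walk D (i - 1) (j - 1) 1 0"
    using exec_loop[of D M ad "cluster_size D + 1" \<rho>1 w] assms(1,3,4) by (auto simp: \<rho>1_def)
  have w: "w > 0" using assms(4) by (cases w) auto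
  have md: "x mod 2 ^ w = x" if "x \<le> 1" for x :: nat
    using that assms(4) by simp
  have mn: "nat ((int x - 1) mod 2 ^ w) = x - 1" if "1 \<le> x" "x \<le> j" for x
    using word_minus[of 1 x w] that ij assms(4) by simp
  have "run w setup_prog ((\<lambda>_. 0)(0 := i, 1 := j, 2 := 1), M) = Some (\<rho>1, M)"
    using ij w by (simp add: setup_prog_def \<rho>1_def md mn) (rule ext, simp)
  \<comment> \<open>Five instructions and the \<open>Skip\<close> that ends a
    \<open>block\<close>.\<close>
  moreover have cost: "cost setup_prog = 6" by (simp add: setup_prog_def block_def)
  ultimately obtain t0 where t0: "t0 \<le> 6" "exec w setup_prog ((\<lambda>_. 0)(0 := i, 1 := j, 2 := 1), M) t0 (\<rho>1, M)"
    using run_exec[of w setup_prog] cost by metis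
  have "exec w (Op 0 OR 3 3) (\<rho>2, M) 1 (\<rho>2(0 := \<rho>2 3), M)"
    using exec.Op[of w 0 OR 3 3 \<rho>2 M] by simp
  from exec.Seq[OF t0(2) exec.Seq[OF t(2) this]]
  have "exec w (Seq setup_prog (Seq (While 5 body) (Op 0 OR 3 3)))
    ((\<lambda>_. 0)(0 := i, 1 := j, 2 := 1), M) (t0 + (t + 1)) (\<rho>2(0 := \<rho>2 3), M)" .
  then have "exec w (If 2 (Seq setup_prog (Seq (While 5 body) (Op 0 OR 3 3))) Skip)
    ((\<lambda>_. 0)(0 := i, 1 := j, 2 := 1), M) (Suc (t0 + (t + 1))) (\<rho>2(0 := \<rho>2 3), M)"
    by (rule exec.If_nonzero[rotated]) simp
  moreover have "exec w (Op 2 LESS 0 1) ((\<lambda>_. 0)(0 := i, 1 := j), M) 1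
      ((\<lambda>_. 0)(0 := i, 1 := j, 2 := 1), M)"
    using exec.Op[of w 2 LESS 0 1 "(\<lambda>_. 0)(0 := i, 1 := j)" M] ij md[of 1] by simp
  ultimately have "exec w rmq_query ((\<lambda>_. 0)(0 := i, 1 := j), M) (1 + Suc (t0 + (t + 1)))
      (\<rho>2(0 := \<rho>2 3), M)"
    unfolding rmq_query_def by (intro exec.Seq)
  then have "answers_query w rmq_query M i j (1 + Suc (t0 + (t + 1))) (walk D (i - 1) (j - 1) 1 0)"
    using t(3) unfolding answers_query_def by fastforce
  moreover have "1 + Suc (t0 + (t + 1)) \<le> (cost body + 1) * (depth D + 1) + 11"
    using t0(1) t(1) by simp
  ultimately show ?thesis by blast
qed

lemma exec_query_same:
  "answers_query w rmq_query M i i (1 + Suc 1) i"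
proof -
  have "exec w (Op 2 LESS 0 1) ((\<lambda>_. 0)(0 := i, 1 := i), M) 1
      ((\<lambda>_. 0)(0 := i, 1 := i, 2 := 0), M)"
    using exec.Op[of w 2 LESS 0 1 "(\<lambda>_. 0)(0 := i, 1 := i)" M] by simp
  moreover have "exec w (If 2 (Seq setup_prog (Seq (While 5 body) (Op 0 OR 3 3))) Skip)
    ((\<lambda>_. 0)(0 := i, 1 := i, 2 := 0), M) (Suc 1) ((\<lambda>_. 0)(0 := i, 1 := i, 2 := 0), M)"
    by (rule exec.If_zero, simp, rule exec.Skip)
  ultimately have "exec w rmq_query ((\<lambda>_. 0)(0 := i, 1 := i), M) (1 + Suc 1)
      ((\<lambda>_. 0)(0 := i, 1 := i, 2 := 0), M)"
    unfolding rmq_query_def by (rule exec.Seq)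
  then show ?thesis unfolding answers_query_def by - (rule exI, rule conjI, assumption, simp)
qed

section \<open>Bounds on the DAG and on the stored words\<close>

lemma cluster_size_dag_nodes: "E \<in> dag_nodes D \<Longrightarrow> cluster_size E \<le> cluster_size D"
proof (induction D)
  case (Merge m A B)
  then show ?case using cluster_size_ge_2[of A] cluster_size_ge_2[of B] by fastforce
qed simp

lemma finite_dag_nodes: "finite (dag_nodes D)"
  by (induction D) auto

text \<open>A binary tree with \<open>e\<close> leaves has \<open>2 * e - 1\<close> nodes, and a
  cluster with \<open>e\<close> edges has \<open>e + 1\<close> vertices; sharing only lowers the
  count. Addresses are thus linear in the length of the string.\<close>

lemma card_dag_nodes: "card (dag_nodes D) + 3 \<le> 2 * cluster_size D"
proof (induction D)
  case (Merge m A B)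
  have "card (dag_nodes (Merge m A B)) \<le> Suc (card (dag_nodes A \<union> dag_nodes B))"
    by (simp add: card_insert_le_m1 card_insert_if finite_dag_nodes)
  also have "\<dots> \<le> Suc (card (dag_nodes A) + card (dag_nodes B))"
    using card_Un_le by simp
  finally show ?case
    using Merge by simp
qed simp

lemma cell_bound:
  assumes "\<And>F. ad F \<le> b" "2 \<le> b" "cluster_size E \<le> b" "x \<in> set (cell ad E)"
  shows "x \<le> b"
proof (cases E)
  case (Single d)
  then show ?thesis using assms(2,4) by auto
next
  case (Merge m A B)
  have "cluster_size A \<le> b" "cluster_size B \<le> b"
    using assms(3) cluster_size_ge_2[of A] cluster_size_ge_2[of B] by (simp_all add: Merge)
  moreover from this have "cluster_size (left_part A B) - 1 \<le> b" by (auto simp: left_part_def)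
  ultimately show ?thesis
    using assms(1,2,4) bottom_index_less[of B] Merge by (cases m) auto
qed

lemma depth_labelled: "depth (labelled T \<T>) = depth \<T>"
proof (induction \<T>)
  case (Single e)
  then show ?case by (cases e) simp
next
  case (Merge m A B)
  then show ?case by (cases m) simp_all
qed

section \<open>From the whole Cartesian tree to the string, and the memory layout\<close>

lemma nodes_prefix: "u @ v \<in> nodes T \<Longrightarrow> u \<in> nodes T"
proof (induction T arbitrary: u)
  case (Node l x r)
  then show ?case by (cases u) auto
qed simp

text \<open>Every other node is the lower end of its parent edge; the root is a vertex only because
  some edge exists, and hence one that leaves the root.\<close>

lemma verts_edges:
  assumes "edges T \<noteq> {}"
  shows "verts (edges T) = nodes T"
proof
  show "verts (edges T) \<subseteq> nodes T"
    using nodes_prefix by (auto simp: verts_def edges_def)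
  show "nodes T \<subseteq> verts (edges T)"
  proof
    fix v assume v: "v \<in> nodes T"
    obtain u d where "u @ [d] \<in> nodes T" using assms by (auto simp: edges_def)
    then obtain e where "[e] \<in> nodes T"
      using nodes_prefix[of "[_]" _ T] by (cases u) auto
    then have e: "([], [e]) \<in> edges T" by (auto simp: edges_def)
    show "v \<in> verts (edges T)"
    proof (cases v rule: rev_cases)
      case Nil
      then show ?thesis using edge_in_verts[OF e] by simp
    next
      case (snoc u d)
      then have "(u, v) \<in> edges T" using v by (auto simp: edges_def)
      then show ?thesis using edge_in_verts by blast
    qed
  qed
qed

lemma walk_top_tree:
  assumes "is_top_tree (cartesian_tree S) \<T>"
  shows "cluster_size (labelled (cartesian_tree S) \<T>) = length S"
    and "1 \<le> i \<Longrightarrow> i < j \<Longrightarrow> j \<le> length S \<Longrightarrow>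
      walk (labelled (cartesian_tree S) \<T>) (i - 1) (j - 1) 1 0 = rmq S i j"
proof -
  define T where "T = cartesian_tree S"
  have H: "cluster_hierarchy T \<T>" "cluster_of \<T> = edges T"
    using assms by (auto simp: is_top_tree_def T_def)
  then have "edges T \<noteq> {}" using hierarchy_cluster[OF H(1)] by (auto simp: cluster_def)
  then have V: "verts (cluster_of \<T>) = nodes T" using H(2) verts_edges by simp
  have card: "card (nodes T) = length S" by (simp add: card_nodes T_def)
  then show "cluster_size (labelled (cartesian_tree S) \<T>) = length S"
    using cluster_size_labelled[OF H(1)] V by (simp add: T_def)
  assume ij: "1 \<le> i" "i < j" "j \<le> length S"
  have ex: "\<exists>u. u \<in> nodes T \<and> index (nodes T) u = k" if "k < length S" for k
    using bij_betw_imp_surj_on[OF bij_betw_index[OF finite_nodes[of T]]] that card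
    by (metis imageE lessThan_iff)
  have less: "i - 1 < length S" "j - 1 < length S" using ij by linarith+
  obtain u where u: "u \<in> nodes T" "index (nodes T) u = i - 1" using ex[of "i - 1"] ij less by blast
  obtain v where v: "v \<in> nodes T" "index (nodes T) v = j - 1" using ex[of "j - 1"] ij less by blast
  have "u \<prec> v"
    using index_less_iff[OF finite_nodes u(1) v(1)] u(2) v(2) diff_less_mono[OF ij(2,1)] by simp
  \<comment> \<open>Nothing is outside the whole tree, so the descent may start with gap 0.\<close>
  have "bottom_nodes T (cluster_of \<T>) = {}" by (simp add: bottom_nodes_def H(2))
  then have "walk (labelled T \<T>) (i - 1) (j - 1) 1 0 = Suc (index (nodes T) (longest_common_prefix u v))"
    using walk_labelled[OF H(1), of u v "\<lambda>a. Suc (index (nodes T) a)" 1 0] u v \<open>u \<prec> v\<close>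
    by (simp add: V)
  also have "\<dots> = rmq S i j"
    using rmq_eq_lca[of u S v] u v \<open>u \<prec> v\<close> ij by (simp add: T_def)
  finally show "walk (labelled (cartesian_tree S) \<T>) (i - 1) (j - 1) 1 0 = rmq S i j"
    by (simp add: T_def)
qed

lemma rmq_same: "rmq S i i = i"
  unfolding rmq_def by (rule Least_equality) (auto simp: is_arg_min_def)

text \<open>The root is put first: its address 0 is a constant of the query program, which therefore
  does not depend on the input.\<close>

lemma dag_layout:
  obtains M ad where "ad D = 0" "\<And>E. E \<in> dag_nodes D \<Longrightarrow> stored M ad E"
    "length M = 5 * card (dag_nodes D)" "\<And>x. x \<in> set M \<Longrightarrow> x \<le> 10 * cluster_size D"
proof -
  obtain xs where xs: "set xs = dag_nodes D - {D}" "distinct xs"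
    using finite_distinct_list[OF finite_Diff[OF finite_dag_nodes]] by blast
  define ds where "ds = D # xs"
  have ds: "set ds = dag_nodes D" "distinct ds" using xs dag_nodes_self by (auto simp: ds_def)
  define ad where "ad E = 5 * length (takeWhile (\<lambda>x. x \<noteq> E) ds)" for E
  define M where "M = map (\<lambda>x. cell ad (ds ! (x div 5)) ! (x mod 5)) [0..<5 * length ds]"
  have len: "length ds = card (dag_nodes D)" using ds distinct_card by metis
  have stored: "stored M ad E" if "E \<in> dag_nodes D" for E
  proof -
    define n where "n = length (takeWhile (\<lambda>x. x \<noteq> E) ds)"
    have "takeWhile (\<lambda>x. x \<noteq> E) ds \<noteq> ds" using that ds(1) by (auto simp: takeWhile_eq_all_conv)
    then have n: "n < length ds"
      unfolding n_def by (metis length_takeWhile_le le_neq_implies_less takeWhile_eq_take take_all_iff order_refl)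
    then have "ds ! n = E" using nth_length_takeWhile[of "\<lambda>x. x \<noteq> E" ds] by (simp add: n_def)
    moreover have "(5 * n + f) div 5 = n" "(5 * n + f) mod 5 = f" if "f < 5" for f
      using that by auto
    ultimately show ?thesis using n by (auto simp: stored_def M_def ad_def n_def[symmetric])
  qed
  have bound: "x \<le> 10 * cluster_size D" if x: "x \<in> set M" for x
  proof -
    obtain y where y: "y < 5 * length ds" "x = cell ad (ds ! (y div 5)) ! (y mod 5)"
      using x by (auto simp: M_def)
    define E where "E = ds ! (y div 5)"
    have E: "E \<in> dag_nodes D" using y(1) ds(1) by (simp add: E_def less_mult_imp_div_less mult.commute flip: ds(1))
    have "length (cell ad E) = 5" by (cases "(ad, E)" rule: cell.cases) auto
    then have "x \<in> set (cell ad E)" using y(2) by (simp add: E_def[symmetric])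
    \<comment> \<open>This includes trees outside the DAG: for them \<open>takeWhile\<close> runs
      through the whole list and the address is \<open>5 * length ds\<close>.\<close>
    moreover have "ad F \<le> 10 * cluster_size D" for F
    proof -
      have "ad F \<le> 5 * length ds" by (simp add: ad_def length_takeWhile_le)
      then show ?thesis using len card_dag_nodes[of D] by simp
    qed
    ultimately show ?thesis
      using cell_bound[of ad "10 * cluster_size D" E x] cluster_size_dag_nodes[OF E]
        cluster_size_ge_2[of D] by simp
  qed
  show thesis
  proof (rule that[OF _ stored _ bound])
    show "ad D = 0" by (simp add: ad_def ds_def)
    show "length M = 5 * card (dag_nodes D)" using len by (simp add: M_def)
  qed
qed

theorem theorem2:
  shows "\<exists>(query :: prog) (c :: nat) (K :: nat).
    \<forall>(S :: int list) (\<T> :: top_tree) (w :: nat).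
      is_top_tree (cartesian_tree S) \<T> \<and> K * length S \<le> 2 ^ w \<longrightarrow>
      (\<exists>M :: nat list.
         length M \<le> c * compressed_size (cartesian_tree S) \<T> \<and>
         (\<forall>x \<in> set M. x < 2 ^ w) \<and>
         (\<forall>i j. 1 \<le> i \<and> i \<le> j \<and> j \<le> length S \<longrightarrow>
            (\<exists>t. t \<le> c * max 1 (depth \<T>) \<and> answers_query w query M i j t (rmq S i j))))"
\<comment> \<open>The factor 2 comes from \<open>depth + 1 \<le> 2 * max 1 depth\<close>; the same
  constant exceeds the five words per DAG node. For a string of length \<open>n\<close>, the memory
  length and all stored words are at most \<open>10 * n\<close>; 20 makes this strictly less than
  \<open>2 ^ w\<close> and leaves room for \<open>n + 3\<close>.\<close>
proof (rule exI[of _ rmq_query], rule exI[of _ "2 * (cost body + 1) + 11"], rule exI[of _ 20],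
    intro allI impI)
  fix S :: "int list" and \<T> :: top_tree and w :: nat
  assume "is_top_tree (cartesian_tree S) \<T> \<and> 20 * length S \<le> 2 ^ w"
  then have tt: "is_top_tree (cartesian_tree S) \<T>" and w: "20 * length S \<le> 2 ^ w" by auto
  let ?c = "2 * (cost body + 1) + 11"
  define D where "D = labelled (cartesian_tree S) \<T>"
  have size: "cluster_size D = length S" using walk_top_tree(1)[OF tt] by (simp add: D_def)
  \<comment> \<open>Clusters are nonempty, so shorter strings have no top-tree.\<close>
  have S: "length S \<ge> 2" using cluster_size_ge_2[of D] size by simp
  obtain M ad where M: "ad D = 0" "\<And>E. E \<in> dag_nodes D \<Longrightarrow> stored M ad E"
    "length M = 5 * card (dag_nodes D)" "\<And>x. x \<in> set M \<Longrightarrow> x \<le> 10 * cluster_size D"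
    by (rule dag_layout[of D]) (rule that)
  have "length M < 2 ^ w" using M(3) card_dag_nodes[of D] size w by simp
  have query: "\<exists>t. t \<le> ?c * max 1 (depth \<T>) \<and> answers_query w rmq_query M i j t (rmq S i j)"
    if ij: "1 \<le> i" "i \<le> j" "j \<le> length S" for i j
  proof (cases "i = j")
    case True
    have "1 + Suc 1 \<le> ?c * max 1 (depth \<T>)"
      by (rule order_trans[of _ "?c * 1"]) simp_all
    then show ?thesis using exec_query_same[of w M i] True by (auto simp: rmq_same)
  next
    case False
    have "(cost body + 1) * (depth D + 1) + 11 \<le> (cost body + 1) * (2 * max 1 (depth \<T>)) + 11 * max 1 (depth \<T>)"
      by (intro add_mono mult_le_mono2) (simp_all add: D_def depth_labelled)
    also have "\<dots> = ?c * max 1 (depth \<T>)" by (simp add: algebra_simps)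
    finally have "(cost body + 1) * (depth D + 1) + 11 \<le> ?c * max 1 (depth \<T>)" .
    moreover obtain t where "t \<le> (cost body + 1) * (depth D + 1) + 11"
      "answers_query w rmq_query M i j t (walk D (i - 1) (j - 1) 1 0)"
      using exec_query[OF M(2,1) \<open>length M < 2 ^ w\<close>, of i j] size S w ij False by auto
    ultimately show ?thesis
      using walk_top_tree(2)[OF tt, of i j] ij False by (auto simp: D_def intro: order_trans)
  qed
  have "length M \<le> ?c * compressed_size (cartesian_tree S) \<T>"
    using M(3) by (simp add: compressed_size_def D_def)
  moreover have "\<forall>x \<in> set M. x < 2 ^ w" using M(4) size w S by fastforce
  ultimately show "\<exists>M. length M \<le> ?c * compressed_size (cartesian_tree S) \<T> \<and>
      (\<forall>x \<in> set M. x < 2 ^ w) \<and>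
      (\<forall>i j. 1 \<le> i \<and> i \<le> j \<and> j \<le> length S \<longrightarrow>
        (\<exists>t. t \<le> ?c * max 1 (depth \<T>) \<and> answers_query w rmq_query M i j t (rmq S i j)))"
    using query by (intro exI[of _ M] conjI allI impI) auto
qed

end
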